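(* Let $G$ be a graph on $n$ vertices with a rooted layout ${\cal L} = (L, \delta)$. Then Subset Vertex Cover can be solved in $n^{O(\mathsf{mim}({\cal L}))}$ time.
   Context: Subset Vertex Cover is the problem: given a graph $G=(V,E)$, a subset $T\subseteq V$ and a positive integer $k$, decide whether $G$ has a $T$-vertex cover of size at most $k$, where a $T$-vertex cover is a set $S\subseteq V$ containing at least one end-vertex of every edge incident to a vertex of $T$. A rooted layout $(L,\delta)$ consists of a rooted binary tree $L$ and a bijection $\delta$ between $V$ and the leaves of $L$; $V_x$ is the set of vertices mapped to leaves descending from node $x$. $\mathsf{mim}(A)$ is the maximum induced matching size in the bipartite graph of edges between $A$ and $V\setminus A$, and $\mathsf{mim}({\cal L})=\max_{x\in V(L)}\mathsf{mim}(V_x)$. *)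

theory Defs
  imports "HOL-Library.Landau_Symbols" "HOL-Library.Sublist"
begin

definition simple_graph :: "'a set \<Rightarrow> 'a set set \<Rightarrow> bool" where
  "simple_graph V E \<longleftrightarrow> finite V \<and> (\<forall>e\<in>E. e \<subseteq> V \<and> card e = 2)"

definition T_vertex_cover :: "'a set \<Rightarrow> 'a set set \<Rightarrow> 'a set \<Rightarrow> 'a set \<Rightarrow> bool" where
  "T_vertex_cover V E T S \<longleftrightarrow> S \<subseteq> V \<and> (\<forall>e\<in>E. e \<inter> T \<noteq> {} \<longrightarrow> e \<inter> S \<noteq> {})"

definition subset_vertex_cover :: "'a set \<Rightarrow> 'a set set \<Rightarrow> 'a set \<Rightarrow> nat \<Rightarrow> bool" where
  "subset_vertex_cover V E T k \<longleftrightarrow> (\<exists>S. T_vertex_cover V E T S \<and> card S \<le> k)"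

definition matching :: "'a set set \<Rightarrow> 'a set set \<Rightarrow> bool" where
  "matching E M \<longleftrightarrow> M \<subseteq> E \<and> (\<forall>e\<in>M. \<forall>f\<in>M. e \<noteq> f \<longrightarrow> e \<inter> f = {})"

definition induced_matching :: "'a set set \<Rightarrow> 'a set set \<Rightarrow> bool" where
  "induced_matching E M \<longleftrightarrow> matching E M \<and> (\<forall>e\<in>E. e \<subseteq> \<Union>M \<longrightarrow> e \<in> M)"

definition cut_edges :: "'a set \<Rightarrow> 'a set set \<Rightarrow> 'a set \<Rightarrow> 'a set set" where
  "cut_edges V E A = {e \<in> E. e \<inter> A \<noteq> {} \<and> e \<inter> (V - A) \<noteq> {}}"

definition mim :: "'a set \<Rightarrow> 'a set set \<Rightarrow> 'a set \<Rightarrow> nat" where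
  "mim V E A = Max {card M | M. induced_matching (cut_edges V E A) M}"

text \<open>
  Every inner node of a rooted binary tree has exactly two children.  A node is identified
  with the path leading to it from the root (\<^term>\<open>False\<close>: first child, \<^term>\<open>True\<close>: second
  child), so that \<open>y\<close> descends from \<open>x\<close> (where \<open>x\<close> descends from itself) iff \<open>x\<close> is a prefix
  of \<open>y\<close>.
\<close>

datatype btree = Leaf | Node btree btree

fun nodes :: "btree \<Rightarrow> bool list set" where
  "nodes Leaf = {[]}"
| "nodes (Node l r) = insert [] ((#) False ` nodes l \<union> (#) True ` nodes r)"

fun leaves :: "btree \<Rightarrow> bool list set" where
  "leaves Leaf = {[]}"
| "leaves (Node l r) = (#) False ` leaves l \<union> (#) True ` leaves r"

definition rooted_layout :: "'a set \<Rightarrow> btree \<Rightarrow> ('a \<Rightarrow> bool list) \<Rightarrow> bool" where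
  "rooted_layout V L \<delta> \<longleftrightarrow> bij_betw \<delta> V (leaves L)"

definition below :: "'a set \<Rightarrow> ('a \<Rightarrow> bool list) \<Rightarrow> bool list \<Rightarrow> 'a set" where
  "below V \<delta> x = {v \<in> V. prefix x (\<delta> v)}"

definition layout_mim :: "'a set \<Rightarrow> 'a set set \<Rightarrow> btree \<Rightarrow> ('a \<Rightarrow> bool list) \<Rightarrow> nat" where
  "layout_mim V E L \<delta> = Max ((\<lambda>x. mim V E (below V \<delta> x)) ` nodes L)"

text \<open>
  Running time is the number of instructions executed by a random access machine (uniform cost
  criterion).  The machine has registers, which a program can only name explicitly, and a memory
  accessed through addresses held in registers; all cells contain natural numbers.  The only
  arithmetic operations are addition and truncated subtraction: with unit-cost multiplication
  the model would no longer be polynomially equivalent to Turing machines.  Jump targets are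
  absolute positions in the program; the machine halts by leaving the program.
\<close>

datatype instr =
    Const nat nat
  | Add nat nat nat
  | Sub nat nat nat
  | Load nat nat
  | Store nat nat
  | Jump nat
  | JumpZero nat nat

datatype config = Config (pc: nat) (regs: "nat \<Rightarrow> nat") (mem: "nat \<Rightarrow> nat")

fun exec :: "instr \<Rightarrow> config \<Rightarrow> config" where
  "exec (Const r c) (Config p R M) = Config (p + 1) (R(r := c)) M"
| "exec (Add r a b) (Config p R M) = Config (p + 1) (R(r := R a + R b)) M"
| "exec (Sub r a b) (Config p R M) = Config (p + 1) (R(r := R a - R b)) M"
| "exec (Load r a) (Config p R M) = Config (p + 1) (R(r := M (R a))) M"
| "exec (Store a r) (Config p R M) = Config (p + 1) R (M(R a := R r))"
| "exec (Jump q) (Config p R M) = Config q R M"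
| "exec (JumpZero r q) (Config p R M) = Config (if R r = 0 then q else p + 1) R M"

definition halted :: "instr list \<Rightarrow> config \<Rightarrow> bool" where
  "halted P c \<longleftrightarrow> length P \<le> pc c"

definition step :: "instr list \<Rightarrow> config \<Rightarrow> config" where
  "step P c = (if halted P c then c else exec (P ! pc c) c)"

definition initial :: "nat list \<Rightarrow> config" where
  "initial w = Config 0 (\<lambda>_. 0) (\<lambda>i. if i < length w then w ! i else 0)"

text \<open>Halted configurations are fixed points of \<open>step\<close>, so \<open>t\<close> is an upper bound on the time.\<close>

definition outputs_within :: "instr list \<Rightarrow> nat list \<Rightarrow> nat \<Rightarrow> nat \<Rightarrow> bool" where
  "outputs_within P w t y \<longleftrightarrow>
     halted P ((step P ^^ t) (initial w)) \<and> regs ((step P ^^ t) (initial w)) 0 = y"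

text \<open>
  The vertices of an input graph on \<open>n\<close> vertices are the numbers below \<open>n\<close>.  The layout is
  listed in postorder: a leaf is written as the successor of its vertex, an inner node as \<open>0\<close>.
  The argument \<open>x\<close> is the position of the current subtree in the whole tree.
\<close>

fun encode_layout :: "nat set \<Rightarrow> (nat \<Rightarrow> bool list) \<Rightarrow> bool list \<Rightarrow> btree \<Rightarrow> nat list" where
  "encode_layout V \<delta> x Leaf = [Suc (the_inv_into V \<delta> x)]"
| "encode_layout V \<delta> x (Node l r) =
     encode_layout V \<delta> (x @ [False]) l @ encode_layout V \<delta> (x @ [True]) r @ [0]"

definition encode_instance ::
  "nat \<Rightarrow> nat set set \<Rightarrow> nat set \<Rightarrow> nat \<Rightarrow> btree \<Rightarrow> (nat \<Rightarrow> bool list) \<Rightarrow> nat list" where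
  "encode_instance n E T k L \<delta> =
     [n, k] @ [of_bool ({i, j} \<in> E). i \<leftarrow> [0..<n], j \<leftarrow> [0..<n]]
     @ [of_bool (i \<in> T). i \<leftarrow> [0..<n]] @ encode_layout {..<n} \<delta> [] L"

text \<open>
  \<open>g\<close> bounds a running time of the form n to the power of O(m).  The Landau symbol refers to
  \<open>m\<close> tending to infinity, so the exponent for \<open>m = 0\<close> is an arbitrary constant: the
  layout of an edgeless graph has \<open>m = 0\<close>, but its input must still be read.  The factor
  \<open>c\<close> only matters for \<open>n = 1\<close>, as it can be absorbed into the exponent if \<open>n \<ge> 2\<close>.
\<close>

definition power_O_bound :: "(nat \<Rightarrow> nat \<Rightarrow> nat) \<Rightarrow> bool" where
  "power_O_bound g \<longleftrightarrow> (\<exists>c f. (\<lambda>m. real (f m)) \<in> O(\<lambda>m. real m) \<and> g = (\<lambda>n m. c * n ^ f m))"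

end

theory Submission imports Defs begin

text \<open>
  A set is a \<open>T\<close>-vertex cover iff its complement is independent in the graph \<open>H\<close> of the edges that
  meet \<open>T\<close>.  A maximum independent set of \<open>H\<close> is found bottom-up along the layout.  Whether
  \<open>X \<subseteq> V\<^sub>x\<close> extends by \<open>Y\<close> outside \<open>V\<^sub>x\<close> depends only on the outer \<open>H\<close>-neighbourhood of \<open>X\<close>, so at each
  node one set per neighbourhood and cardinality suffices.  The outer \<open>H\<close>-neighbourhood of \<open>X\<close>
  is the one of \<open>R \<union> R'\<close>, where \<open>R \<subseteq> X \<inter> T\<close> has the same outer neighbours in \<open>G\<close> as \<open>X \<inter> T\<close>
  and \<open>R' \<subseteq> X\<close> the same outer neighbours in \<open>T\<close> as \<open>X\<close>.  Minimal such sets induce matchings of the cut,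
  so both have at most \<open>mim\<close> elements, and only \<open>(n + 1)\<close> to the power of \<open>2 mim\<close> neighbourhoods
  occur.  The machine never needs to know \<open>mim\<close>.
\<close>

section \<open>Counted loops on the machine\<close>

text \<open>The bound cannot come from induced matchings of \<open>H\<close> itself: deleting edges
  of \<open>G\<close> can turn a matching into an induced one, so a cut may have larger induced
  matchings in \<open>H\<close> than in \<open>G\<close>. Hence the neighbourhood argument is
  applied to \<open>G\<close> only, on the two kinds of crossing pairs for which
  \<open>G\<close>-edges and \<open>H\<close>-edges coincide: inner end in \<open>T\<close>, or
  outer end in \<open>T\<close>. This is the origin of the factor 2 in the exponent. Candidates are
  kept for every cardinality, not only the largest. An exchange then preserves size exactly and the
  first candidate found can stay for good; the price is one more factor \<open>n + 1\<close>. For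
  the time bound, one number \<open>B\<close> above \<open>2 * n\<close> and above all table lengths
  bounds every loop counter. The deepest nest has six loops, so the time is a constant times
  \<open>(B + 1) ^ 6\<close>, and an exponent linear in mim for \<open>B\<close> remains
  linear.\<close>

text \<open>
  \<open>For r c\<close> repeats \<open>c\<close> as often as register \<open>r\<close> says on entry, counting \<open>r\<close> down to \<open>0\<close>; this
  reading is only correct if \<open>c\<close> leaves \<open>r\<close> alone, which \<open>wf_com\<close> demands.  Register 2 is scratch
  space for the constant 1.
\<close>

datatype com = Instr instr | Seq com com (infixr ";;" 60) | For nat com

type_synonym state = "(nat \<Rightarrow> nat) \<times> (nat \<Rightarrow> nat)"

fun config_of :: "nat \<Rightarrow> state \<Rightarrow> config" where
  "config_of p (R, M) = Config p R M"

fun apply_instr :: "instr \<Rightarrow> state \<Rightarrow> state" where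
  "apply_instr i (R, M) = (regs (exec i (Config 0 R M)), mem (exec i (Config 0 R M)))"

text \<open>The joint effect of \<open>Const 2 1\<close> and \<open>Sub r r 2\<close>, which open
  every iteration of a compiled loop.\<close>

fun countdown :: "nat \<Rightarrow> state \<Rightarrow> state" where
  "countdown r (R, M) = (R(2 := 1, r := R r - 1), M)"

primrec run :: "com \<Rightarrow> state \<Rightarrow> state" where
  "run (Instr i) = apply_instr i"
| "run (a ;; b) = run b \<circ> run a"
| "run (For r c) = (\<lambda>s. ((run c \<circ> countdown r) ^^ fst s r) s)"

text \<open>Counters such as list lengths depend on the data, so the bound is demanded along the
  actual run, at each entry of each inner loop.\<close>

primrec loops_bounded :: "nat \<Rightarrow> com \<Rightarrow> state \<Rightarrow> bool" where
  "loops_bounded B (Instr i) = (\<lambda>s. True)"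
| "loops_bounded B (a ;; b) = (\<lambda>s. loops_bounded B a s \<and> loops_bounded B b (run a s))"
| "loops_bounded B (For r c) = (\<lambda>s. fst s r \<le> B \<and>
     (\<forall>i<fst s r. loops_bounded B c (countdown r (((run c \<circ> countdown r) ^^ i) s))))"

fun instr_writes :: "instr \<Rightarrow> nat set" where
  "instr_writes (Const r c) = {r}"
| "instr_writes (Add r a b) = {r}"
| "instr_writes (Sub r a b) = {r}"
| "instr_writes (Load r a) = {r}"
| "instr_writes _ = {}"

primrec writes :: "com \<Rightarrow> nat set" where
  "writes (Instr i) = instr_writes i"
| "writes (a ;; b) = writes a \<union> writes b"
| "writes (For r c) = insert 2 (insert r (writes c))"

fun straight :: "instr \<Rightarrow> bool" where
  "straight (Jump q) = False"
| "straight (JumpZero r q) = False"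
| "straight _ = True"

primrec wf_com :: "com \<Rightarrow> bool" where
  "wf_com (Instr i) = straight i"
| "wf_com (a ;; b) = (wf_com a \<and> wf_com b)"
| "wf_com (For r c) = (r \<noteq> 2 \<and> r \<notin> writes c \<and> wf_com c)"

primrec code_length :: "com \<Rightarrow> nat" where
  "code_length (Instr i) = 1"
| "code_length (a ;; b) = code_length a + code_length b"
| "code_length (For r c) = code_length c + 4"

primrec compile :: "com \<Rightarrow> nat \<Rightarrow> instr list" where
  "compile (Instr i) = (\<lambda>p. [i])"
| "compile (a ;; b) = (\<lambda>p. compile a p @ compile b (p + code_length a))"
| "compile (For r c) = (\<lambda>p.
     [JumpZero r (p + code_length c + 4), Const 2 1, Sub r r 2] @ compile c (p + 3) @ [Jump p])"

text \<open>Bounding all loop counters by \<open>B\<close> bounds the running time by a polynomial in \<open>B\<close> whose degree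
  is the nesting depth, so no step has to be counted in the verification of a program.\<close>

primrec cost :: "nat \<Rightarrow> com \<Rightarrow> nat" where
  "cost B (Instr i) = 1"
| "cost B (a ;; b) = cost B a + cost B b"
| "cost B (For r c) = B * (cost B c + 4) + 1"

primrec depth :: "com \<Rightarrow> nat" where
  "depth (Instr i) = 0"
| "depth (a ;; b) = max (depth a) (depth b)"
| "depth (For r c) = Suc (depth c)"

lemma length_compile [simp]: "length (compile c p) = code_length c"
  by (induction c arbitrary: p) auto

text \<open>The four control instructions that a loop adds to \<open>code_length\<close> pay for its
  overhead per iteration; one factor \<open>B + 1\<close> covers the iterations and the final
  test.\<close>

lemma cost_le: "cost B c \<le> 2 * code_length c * (B + 1) ^ depth c"
proof (induction c)
  case (Seq a b)
  have mono: "(B + 1) ^ depth a \<le> (B + 1) ^ depth (a ;; b)" "(B + 1) ^ depth b \<le> (B + 1) ^ depth (a ;; b)"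
    by (intro power_increasing; simp)+
  have "cost B (a ;; b) \<le> 2 * code_length a * (B + 1) ^ depth a + 2 * code_length b * (B + 1) ^ depth b"
    using Seq by simp
  also have "\<dots> \<le> 2 * code_length a * (B + 1) ^ depth (a ;; b) + 2 * code_length b * (B + 1) ^ depth (a ;; b)"
    using mono by (intro add_mono mult_left_mono) auto
  finally show ?case by (simp add: algebra_simps)
next
  case (For r c)
  let ?Y = "(B + 1) ^ depth c"
  have Y: "1 \<le> ?Y" by simp
  have "cost B (For r c) \<le> (B + 1) * (cost B c + 4)" by simp
  also have "\<dots> \<le> (B + 1) * (2 * code_length c * ?Y + 8 * ?Y)"
    using For Y by (intro mult_left_mono add_mono) linarith+
  also have "\<dots> = 2 * code_length (For r c) * (B + 1) ^ depth (For r c)"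
    by (simp add: algebra_simps)
  finally show ?case .
qed auto

lemma run_unwritten: "x \<notin> writes c \<Longrightarrow> fst (run c s) x = fst s x"
proof (induction c arbitrary: s)
  case (Instr i)
  then show ?case by (cases s; cases i) auto
next
  case (For r c)
  have "fst (((run c \<circ> countdown r) ^^ k) s) x = fst s x" for k
  proof (induction k)
    case (Suc k)
    have "fst (countdown r t) x = fst t x" for t using For.prems by (cases t) auto
    then show ?case using For Suc by simp
  qed simp
  then show ?case by simp
qed auto

lemma funpow_add_app: "(f ^^ b) ((f ^^ a) x) = (f ^^ (a + b)) x"
  by (simp add: add.commute[of a b] funpow_add)

lemma step_at:
  assumes "P = pre @ i # post"
  shows "step P (Config (length pre) R M) = exec i (Config (length pre) R M)"
  using assms by (simp add: step_def halted_def)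

text \<open>Jump targets are absolute, so the code is considered at an arbitrary offset with
  arbitrary code around it.\<close>

lemma compile_correct:
  assumes "wf_com c" "loops_bounded B c s" "P = pre @ compile c (length pre) @ post"
  shows "\<exists>t\<le>cost B c. (step P ^^ t) (config_of (length pre) s) =
           config_of (length pre + code_length c) (run c s)"
  using assms
proof (induction c arbitrary: s pre post)
  case (Instr i)
  obtain R M where s: "s = (R, M)" by force
  have "step P (Config (length pre) R M) = exec i (Config (length pre) R M)"
    using Instr(3) by (intro step_at[of _ _ _ post]) auto
  then show ?case using Instr(1) s by (intro exI[of _ 1]; cases i) auto
next
  case (Seq a b)
  obtain t where t: "t \<le> cost B a"
    "(step P ^^ t) (config_of (length pre) s) = config_of (length pre + code_length a) (run a s)"
    using Seq(1)[of s pre "compile b (length pre + code_length a) @ post"] Seq.prems by auto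
  obtain t' where t': "t' \<le> cost B b"
    "(step P ^^ t') (config_of (length pre + code_length a) (run a s)) =
      config_of (length pre + code_length a + code_length b) (run b (run a s))"
    using Seq(2)[of "run a s" "pre @ compile a (length pre)" post] Seq.prems by auto
  show ?case
    using t t' by (intro exI[of _ "t + t'"]) (simp add: add.assoc flip: funpow_add_app)
next
  case (For r c)
  let ?p = "length pre"
  define body where "body = run c \<circ> countdown r"
  have P: "P = pre @ JumpZero r (?p + code_length c + 4) # Const 2 1 # Sub r r 2 #
                 compile c (?p + 3) @ Jump ?p # post"
    using For.prems by simp
  have r: "r \<noteq> 2" "r \<notin> writes c" "wf_com c" using For.prems by auto
  \<comment> \<open>Induction on the number \<open>N\<close> of remaining iterations, for any state
    at the loop head whose counter is \<open>N\<close>.\<close>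
  have iter: "\<exists>t\<le>N * (cost B c + 4) + 1. (step P ^^ t) (config_of ?p s) =
           config_of (?p + code_length c + 4) ((body ^^ N) s)"
    if "fst s r = N" "\<forall>i<N. loops_bounded B c (countdown r ((body ^^ i) s))" for N s
    using that
  proof (induction N arbitrary: s)
    case 0
    obtain R M where s: "s = (R, M)" by force
    have "step P (Config ?p R M) = exec (JumpZero r (?p + code_length c + 4)) (Config ?p R M)"
      by (rule step_at[OF P])
    then show ?case using 0 s by (intro exI[of _ 1]) auto
  next
    case (Suc N)
    obtain R M where s: "s = (R, M)" by force
    have s1: "step P (Config ?p R M) = Config (?p + 1) R M"
      using step_at[OF P, of R M] Suc s by auto
    have s2: "step P (Config (?p + 1) R M) = Config (?p + 2) (R(2 := 1)) M"
      using step_at[of P "pre @ [JumpZero r (?p + code_length c + 4)]" _ _ R M] P by auto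
    have s3: "step P (Config (?p + 2) (R(2 := 1)) M) = config_of (?p + 3) (countdown r s)"
      using step_at[of P "pre @ [JumpZero r (?p + code_length c + 4), Const 2 1]" _ _ "R(2 := 1)" M] P r s
      by auto
    have a: "(step P ^^ 3) (config_of ?p s) = config_of (?p + 3) (countdown r s)"
      using s1 s2 s3 s by (simp add: eval_nat_numeral)
    define pre' where "pre' = pre @ [JumpZero r (?p + code_length c + 4), Const 2 1, Sub r r 2]"
    have pre': "length pre' = ?p + 3" "P = pre' @ compile c (length pre') @ Jump ?p # post"
      using P by (simp_all add: pre'_def numeral_3_eq_3)
    have "loops_bounded B c (countdown r s)" using Suc.prems(2) by (metis funpow_0 zero_less_Suc)
    then obtain t where t: "t \<le> cost B c" "(step P ^^ t) (config_of (?p + 3) (countdown r s)) =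
        config_of (?p + 3 + code_length c) (body s)"
      using For.IH[OF r(3) _ pre'(2), of "countdown r s"] unfolding pre'(1) body_def by auto
    obtain R' M' where s': "body s = (R', M')" by force
    have d: "step P (config_of (?p + 3 + code_length c) (body s)) = config_of ?p (body s)"
      using step_at[of P "pre' @ compile c (length pre')" "Jump ?p" post R' M'] pre' s' by simp
    have "fst (body s) r = N"
      using r Suc.prems s by (simp add: body_def run_unwritten)
    moreover have "\<forall>i<N. loops_bounded B c (countdown r ((body ^^ i) (body s)))"
    proof (intro allI impI)
      fix i assume "i < N"
      then have "loops_bounded B c (countdown r ((body ^^ Suc i) s))"
        using Suc.prems(2) Suc_less_eq by blast
      then show "loops_bounded B c (countdown r ((body ^^ i) (body s)))"
        by (simp add: funpow_swap1)
    qed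
    ultimately obtain t' where t': "t' \<le> N * (cost B c + 4) + 1"
      "(step P ^^ t') (config_of ?p (body s)) = config_of (?p + code_length c + 4) ((body ^^ N) (body s))"
      using Suc.IH by blast
    \<comment> \<open>Three steps test and decrement the counter, \<open>t\<close> run the body, one
      jumps back, and \<open>t'\<close> do the remaining iterations.\<close>
    have "(step P ^^ (3 + (t + (1 + t')))) (config_of ?p s) =
        config_of (?p + code_length c + 4) ((body ^^ Suc N) s)"
      unfolding funpow_add_app[symmetric] a t(2) using d t'(2) by (simp add: funpow_swap1)
    moreover have "3 + (t + (1 + t')) \<le> Suc N * (cost B c + 4) + 1" using t(1) t'(1) by simp
    ultimately show ?case by blast
  qed
  have b: "fst s r \<le> B" "\<forall>i<fst s r. loops_bounded B c (countdown r ((body ^^ i) s))"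
    using For.prems unfolding body_def by auto
  obtain t where t: "t \<le> fst s r * (cost B c + 4) + 1" "(step P ^^ t) (config_of ?p s) =
           config_of (?p + code_length c + 4) ((body ^^ fst s r) s)"
    using iter[OF refl b(2)] by blast
  have "t \<le> cost B (For r c)"
    unfolding cost.simps by (rule order.trans[OF t(1)]) (intro add_mono mult_le_mono1 b(1) order.refl)
  then show ?case using t(2) unfolding body_def by (intro exI[of _ t]) (simp add: add.assoc)
qed

lemma step_halted: "halted P c \<Longrightarrow> (step P ^^ t) c = c"
  by (induction t) (auto simp: step_def)

text \<open>A machine that halts early stays where it is, so any upper bound on the cost may serve
  as \<open>t\<close>.\<close>

lemma compile_outputs_within:
  assumes "wf_com c" "loops_bounded B c (R, M)" "initial w = Config 0 R M" "cost B c \<le> t"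
    "fst (run c (R, M)) 0 = y"
  shows "outputs_within (compile c 0) w t y"
proof -
  obtain t' where t': "t' \<le> cost B c"
    "(step (compile c 0) ^^ t') (initial w) = config_of (code_length c) (run c (R, M))"
    using compile_correct[OF assms(1,2), of "compile c 0" "[]" "[]"] assms(3) by auto
  obtain R' M' where r: "run c (R, M) = (R', M')" by force
  have h: "halted (compile c 0) (config_of (code_length c) (run c (R, M)))"
    using r by (simp add: halted_def)
  have "(step (compile c 0) ^^ t) (initial w) =
      (step (compile c 0) ^^ (t - t')) ((step (compile c 0) ^^ t') (initial w))"
    using t'(1) assms(4) by (simp add: funpow_add_app)
  also have "\<dots> = config_of (code_length c) (run c (R, M))"
    unfolding t'(2) by (rule step_halted[OF h])
  finally show ?thesis using h r assms(5) by (simp add: outputs_within_def)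
qed

section \<open>Program verification: one predicate for result and loop bounds\<close>

definition wp :: "nat \<Rightarrow> com \<Rightarrow> ((nat \<Rightarrow> nat) \<Rightarrow> (nat \<Rightarrow> nat) \<Rightarrow> bool) \<Rightarrow> (nat \<Rightarrow> nat) \<Rightarrow> (nat \<Rightarrow> nat) \<Rightarrow> bool" where
  "wp B c Q R M \<longleftrightarrow> loops_bounded B c (R, M) \<and> Q (fst (run c (R, M))) (snd (run c (R, M)))"

lemma wp_simps [simp]:
  "wp B (Instr (Const r k)) Q R M = Q (R(r := k)) M"
  "wp B (Instr (Add r a b)) Q R M = Q (R(r := R a + R b)) M"
  "wp B (Instr (Sub r a b)) Q R M = Q (R(r := R a - R b)) M"
  "wp B (Instr (Load r a)) Q R M = Q (R(r := M (R a))) M"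
  "wp B (Instr (Store a r)) Q R M = Q R (M(R a := R r))"
  "wp B (c ;; d) Q R M = wp B c (wp B d Q) R M"
  by (auto simp: wp_def)

text \<open>\<open>Inv i\<close> speaks of the loop head after \<open>i\<close> iterations. The rule
  itself supplies the value of the counter and of all unwritten registers, so an invariant mentions
  only what changes.\<close>

lemma wp_For:
  assumes B: "R r \<le> B" and r: "r \<noteq> 2" "r \<notin> writes c"
    and init: "Inv 0 R M"
    and body: "\<And>i R' M'. \<lbrakk>i < R r; Inv i R' M'; R' r = R r - i;
        \<And>x. x \<notin> insert 2 (insert r (writes c)) \<Longrightarrow> R' x = R x\<rbrakk> \<Longrightarrow>
        wp B c (Inv (Suc i)) (R'(2 := 1, r := R r - Suc i)) M'"
    and post: "\<And>R' M'. \<lbrakk>Inv (R r) R' M'; R' r = 0;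
        \<And>x. x \<notin> insert 2 (insert r (writes c)) \<Longrightarrow> R' x = R x\<rbrakk> \<Longrightarrow> Q R' M'"
  shows "wp B (For r c) Q R M"
proof -
  define S where "S i = ((run c \<circ> countdown r) ^^ i) (R, M)" for i
  have S0: "S 0 = (R, M)" by (simp add: S_def)
  have SSuc: "S (Suc i) = run c (countdown r (S i))" for i by (simp add: S_def)
  have main: "Inv i (fst (S i)) (snd (S i)) \<and> fst (S i) r = R r - i \<and>
      (\<forall>x. x \<notin> insert 2 (insert r (writes c)) \<longrightarrow> fst (S i) x = R x) \<and>
      (\<forall>j<i. loops_bounded B c (countdown r (S j)))" if "i \<le> R r" for i
    using that
  proof (induction i)
    case 0
    then show ?case using init S0 by simp
  next
    case (Suc i)
    obtain R' M' where s: "S i = (R', M')" by force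
    have IH: "Inv i R' M'" "R' r = R r - i" "\<And>x. x \<notin> insert 2 (insert r (writes c)) \<Longrightarrow> R' x = R x"
      "\<forall>j<i. loops_bounded B c (countdown r (S j))"
      using Suc s by auto
    have cd: "countdown r (S i) = (R'(2 := 1, r := R r - Suc i), M')"
      using IH(2) s by simp
    have w: "wp B c (Inv (Suc i)) (R'(2 := 1, r := R r - Suc i)) M'"
      using Suc.prems by (intro body IH) auto
    have "fst (S (Suc i)) x = R x" if "x \<notin> insert 2 (insert r (writes c))" for x
      using that IH(3)[OF that] unfolding SSuc cd by (simp add: run_unwritten)
    moreover have "fst (S (Suc i)) r = R r - Suc i"
      using r unfolding SSuc cd by (simp add: run_unwritten)
    moreover have "\<forall>j<Suc i. loops_bounded B c (countdown r (S j))"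
      using IH(4) w cd by (simp add: wp_def less_Suc_eq)
    moreover have "Inv (Suc i) (fst (S (Suc i))) (snd (S (Suc i)))"
      using w unfolding SSuc cd wp_def by simp
    ultimately show ?case by blast
  qed
  have "Q (fst (S (R r))) (snd (S (R r)))"
    using main[of "R r"] by (intro post) auto
  then show ?thesis
    using B main[of "R r"] unfolding wp_def S_def by (simp add: comp_def)
qed

text \<open>A loop whose counter is 0 or 1 is the only conditional of the language; it consumes its
  flag.\<close>

lemma wp_If:
  assumes "R r \<le> B" "R r \<le> 1" "r \<noteq> 2" "r \<notin> writes c"
    and "R r = 0 \<Longrightarrow> Q R M"
    and "R r = 1 \<Longrightarrow> wp B c Q (R(2 := 1, r := 0)) M"
  shows "wp B (For r c) Q R M"
  using assms by (cases "R r") (auto simp: wp_def)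

section \<open>The dynamic program\<close>

text \<open>
  A candidate \<open>X \<subseteq> A\<close> is stored as the vector \<open>code A X\<close> below: inside \<open>A\<close>, the entry is 3 for elements of
  \<open>X\<close> and 2 for the others; outside \<open>A\<close>, it is 1 for \<open>H\<close>-neighbours of \<open>X\<close> and 0 for the others.
  With this encoding the union of candidates over disjoint sets is the pointwise maximum, an
  edge between them shows as entries 3 and 1 with sum 4, and two candidates over the same set differ in
  their outer neighbourhoods iff some entries have sum 1.
\<close>

definition merge :: "(nat \<Rightarrow> nat) \<Rightarrow> (nat \<Rightarrow> nat) \<Rightarrow> nat \<Rightarrow> nat" where
  "merge x y = (\<lambda>u. max (x u) (y u))"

definition conflict :: "(nat \<Rightarrow> nat) \<Rightarrow> (nat \<Rightarrow> nat) \<Rightarrow> bool" where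
  "conflict x y \<longleftrightarrow> (\<exists>u. x u + y u = 4)"

text \<open>Truncated subtraction maps the entry 3 to 1 and the entries 0, 1 and 2 to 0, so on code
  vectors this is the number of chosen vertices.\<close>

definition weight :: "nat \<Rightarrow> (nat \<Rightarrow> nat) \<Rightarrow> nat" where
  "weight n x = (\<Sum>u<n. x u - 2)"

definition eqv :: "nat \<Rightarrow> (nat \<Rightarrow> nat) \<Rightarrow> (nat \<Rightarrow> nat) \<Rightarrow> bool" where
  "eqv n x y \<longleftrightarrow> (\<forall>u. x u + y u \<noteq> 1) \<and> weight n x = weight n y"

definition join_one :: "nat \<Rightarrow> (nat \<Rightarrow> nat) \<Rightarrow> (nat \<Rightarrow> nat) \<Rightarrow> (nat \<Rightarrow> nat) list \<Rightarrow> (nat \<Rightarrow> nat) list" where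
  "join_one n x y zs =
     (if conflict x y \<or> (\<exists>z\<in>set zs. eqv n (merge x y) z) then zs else zs @ [merge x y])"

definition join :: "nat \<Rightarrow> (nat \<Rightarrow> nat) list \<Rightarrow> (nat \<Rightarrow> nat) list \<Rightarrow> (nat \<Rightarrow> nat) list" where
  "join n xs ys = fold (\<lambda>x. fold (join_one n x) ys) xs []"

lemma fold_reaches:
  assumes "x \<in> set xs" "\<And>s. P (f x s)" "\<And>y s. P s \<Longrightarrow> P (f y s)"
  shows "P (fold f xs s)"
proof -
  have keep: "P s \<Longrightarrow> P (fold f ys s)" for ys s
    using assms(3) by (induction ys arbitrary: s) auto
  show ?thesis using assms(1) by (induction xs arbitrary: s) (auto intro: keep assms(2))
qed

lemma join_one_mono: "set zs \<subseteq> set (join_one n x y zs)"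
  by (auto simp: join_one_def)

lemma fold_join_one_mono: "set zs \<subseteq> set (fold (join_one n x) ys zs)"
  using join_one_mono by (induction ys arbitrary: zs) fastforce+

lemma length_join_one: "length zs \<le> length (join_one n x y zs)"
  by (auto simp: join_one_def)

lemma length_fold_join_one: "length zs \<le> length (fold (join_one n x) ys zs)"
  by (induction ys arbitrary: zs) (auto intro: order.trans[OF length_join_one])

text \<open>The pass for the pair \<open>x\<close>, \<open>y\<close> puts a witness into the list,
  and later passes only append.\<close>

lemma join_covers:
  assumes "x \<in> set xs" "y \<in> set ys" "\<not> conflict x y"
  shows "\<exists>z\<in>set (join n xs ys). z = merge x y \<or> eqv n (merge x y) z"
  unfolding join_def
proof (rule fold_reaches[OF assms(1)])
  show "\<exists>z\<in>set (fold (join_one n x) ys s). z = merge x y \<or> eqv n (merge x y) z" for s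
  proof (rule fold_reaches[OF assms(2)])
    show "\<exists>z\<in>set (join_one n x y s). z = merge x y \<or> eqv n (merge x y) z" for s
      using assms(3) by (auto simp: join_one_def)
  qed (use join_one_mono in blast)
qed (use fold_join_one_mono in blast)

lemma join_invariant:
  assumes "I []" "\<And>x y zs. x \<in> set xs \<Longrightarrow> y \<in> set ys \<Longrightarrow> I zs \<Longrightarrow> I (join_one n x y zs)"
  shows "I (join n xs ys)"
  unfolding join_def
proof (rule fold_invariant[where Q = "\<lambda>x. x \<in> set xs"])
  fix x s assume "x \<in> set xs" "I s"
  then show "I (fold (join_one n x) ys s)"
    using assms(2) by (intro fold_invariant[where Q = "\<lambda>y. y \<in> set ys" and P = I]) auto
qed (use assms(1) in auto)

section \<open>Counting neighbourhoods by induced matchings\<close>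

lemma card_small_subsets:
  "finite {R. R \<subseteq> {..<n::nat} \<and> card R \<le> w}" "card {R. R \<subseteq> {..<n::nat} \<and> card R \<le> w} \<le> (n + 1) ^ w"
proof -
  let ?L = "{l. set l \<subseteq> {..n} \<and> length l = w}"
  have "{R. R \<subseteq> {..<n} \<and> card R \<le> w} \<subseteq> (\<lambda>l. set l \<inter> {..<n}) ` ?L"
  proof clarify
    fix R assume R: "R \<subseteq> {..<n}" "card R \<le> w"
    then have "finite R" using finite_subset by blast
    \<comment> \<open>The number \<open>n\<close>, which is no vertex, pads the list to length
      \<open>w\<close>; this is why there are \<open>n + 1\<close> symbols.\<close>
    let ?l = "sorted_list_of_set R @ replicate (w - card R) n"
    have "set ?l = R \<union> (if w - card R = 0 then {} else {n})"
      using \<open>finite R\<close> by (simp add: set_replicate_conv_if del: set_replicate)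
    then have "set ?l \<subseteq> {..n}" "R = set ?l \<inter> {..<n}"
      using R(1) by (auto split: if_splits)
    moreover have "length ?l = w" using R(2) \<open>finite R\<close> by simp
    ultimately show "R \<in> (\<lambda>l. set l \<inter> {..<n}) ` ?L" by blast
  qed
  moreover have L: "finite ?L" "card ?L = (n + 1) ^ w"
    using finite_lists_length_eq[of "{..n}" w] card_lists_length_eq[of "{..n}" w] by auto
  ultimately show "finite {R. R \<subseteq> {..<n} \<and> card R \<le> w}" "card {R. R \<subseteq> {..<n} \<and> card R \<le> w} \<le> (n + 1) ^ w"
    using finite_surj[OF L(1)] surj_card_le[OF L(1)] unfolding L(2) by blast+
qed

lemma card_induced_matching_le_mim:
  assumes "finite E" "induced_matching (cut_edges V E A) M"
  shows "card M \<le> mim V E A"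
  unfolding mim_def
proof (rule Max_ge)
  have "{card M |M. induced_matching (cut_edges V E A) M} \<subseteq> card ` Pow E"
    by (auto simp: induced_matching_def matching_def cut_edges_def)
  then show "finite {card M |M. induced_matching (cut_edges V E A) M}"
    using assms(1) finite_subset by blast
qed (use assms(2) in blast)

text \<open>A vertex of a minimal subset of \<open>X\<close> with the same neighbours in \<open>Q\<close> has a private neighbour,
  and these private edges form an induced matching of the cut.\<close>

lemma neighbourhood_representative:
  assumes G: "simple_graph V E" and X: "X \<subseteq> A" "A \<subseteq> V" and Q: "Q \<subseteq> V - A"
  shows "\<exists>R\<subseteq>X. card R \<le> mim V E A \<and> (\<forall>q\<in>Q. (\<exists>x\<in>X. {x, q} \<in> E) \<longleftrightarrow> (\<exists>x\<in>R. {x, q} \<in> E))"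
proof -
  have "E \<subseteq> Pow V" "finite V" using G by (auto simp: simple_graph_def)
  then have E: "finite E" and "finite X" using X finite_subset by (blast, metis finite_subset)
  define good where "good R \<longleftrightarrow> R \<subseteq> X \<and> (\<forall>q\<in>Q. (\<exists>x\<in>X. {x, q} \<in> E) \<longleftrightarrow> (\<exists>x\<in>R. {x, q} \<in> E))" for R
  have good_X: "good X" by (simp add: good_def)
  obtain R where R: "good R" and min: "\<And>R'. good R' \<Longrightarrow> card R \<le> card R'"
    using ex_has_least_nat[of good X card] good_X by metis
  have RX: "R \<subseteq> X" "finite R" using R \<open>finite X\<close> finite_subset by (auto simp: good_def)
  have "\<exists>q\<in>Q. {r, q} \<in> E \<and> (\<forall>x\<in>R. {x, q} \<in> E \<longrightarrow> x = r)" if "r \<in> R" for r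
  proof -
    have "\<not> good (R - {r})"
      using min[of "R - {r}"] that RX(2) card_Diff1_less[of R r] by force
    then show ?thesis using R that unfolding good_def by blast
  qed
  then obtain p where p: "\<And>r. r \<in> R \<Longrightarrow> p r \<in> Q \<and> {r, p r} \<in> E \<and> (\<forall>x\<in>R. {x, p r} \<in> E \<longrightarrow> x = r)"
    by metis
  let ?M = "(\<lambda>r. {r, p r}) ` R"
  have out: "r \<in> A" "p r \<in> V" "p r \<notin> A" if "r \<in> R" for r
    using that RX X Q p by blast+
  have "inj_on (\<lambda>r. {r, p r}) R"
    by (rule inj_onI) (use out in \<open>force simp: doubleton_eq_iff\<close>)
  then have "card ?M = card R" by (rule card_image)
  moreover have "induced_matching (cut_edges V E A) ?M"
  proof -
    have sub: "?M \<subseteq> cut_edges V E A"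
      using p out by (auto simp: cut_edges_def)
    have disj: "{r, p r} \<inter> {s, p s} = {}" if "r \<in> R" "s \<in> R" "{r, p r} \<noteq> {s, p s}" for r s
    proof -
      have "r \<noteq> s" using that by auto
      moreover have "p r \<noteq> p s" using p that \<open>r \<noteq> s\<close> by metis
      ultimately show ?thesis using out that by fastforce
    qed
    \<comment> \<open>Such an edge joins some \<open>a\<close> in \<open>R\<close> to a private
      neighbour \<open>p r\<close>, and privacy forces \<open>a = r\<close>.\<close>
    have "e \<in> ?M" if e: "e \<in> cut_edges V E A" "e \<subseteq> \<Union> ?M" for e
    proof -
      obtain a b where ab: "a \<in> e" "a \<in> A" "b \<in> e" "b \<notin> A" using e by (auto simp: cut_edges_def)
      obtain r where r: "r \<in> R" "b = p r" using ab e out by blast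
      have "a \<in> R" using ab e out by blast
      have "card e = 2" using e(1) G by (simp add: simple_graph_def cut_edges_def)
      then obtain u v where "e = {u, v}" by (auto simp: card_2_iff)
      then have "e = {a, b}" using ab by auto
      then show ?thesis using e \<open>a \<in> R\<close> p r by (auto simp: cut_edges_def)
    qed
    then show ?thesis using sub disj unfolding induced_matching_def matching_def by blast
  qed
  ultimately have "card R \<le> mim V E A"
    using card_induced_matching_le_mim[OF E] by metis
  then show ?thesis using R by (auto simp: good_def)
qed

section \<open>Independent sets of \<open>H\<close> and their code vectors\<close>

locale svc_instance =
  fixes n :: nat and E :: "nat set set" and T :: "nat set"
  assumes graph: "simple_graph {..<n} E"
begin

text \<open>Adjacency in the graph \<open>H\<close> of the overview.\<close>

definition adj :: "nat \<Rightarrow> nat \<Rightarrow> bool" where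
  "adj u v \<longleftrightarrow> {u, v} \<in> E \<and> (u \<in> T \<or> v \<in> T)"

definition indep :: "nat set \<Rightarrow> bool" where
  "indep X \<longleftrightarrow> (\<forall>u\<in>X. \<forall>v\<in>X. \<not> adj u v)"

definition nbrs_outside :: "nat set \<Rightarrow> nat set \<Rightarrow> nat set" where
  "nbrs_outside A X = {u. u \<notin> A \<and> (\<exists>x\<in>X. adj x u)}"

definition code :: "nat set \<Rightarrow> nat set \<Rightarrow> nat \<Rightarrow> nat" where
  "code A X = (\<lambda>u. if u \<in> A then if u \<in> X then 3 else 2 else if \<exists>x\<in>X. adj x u then 1 else 0)"

text \<open>Soundness, completeness and irredundancy; the last one bounds the length. Its argument
  order is that of the test in \<open>join_one\<close>, where a new vector is compared with earlier
  ones.\<close>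

definition represents :: "nat set \<Rightarrow> (nat \<Rightarrow> nat) list \<Rightarrow> bool" where
  "represents A xs \<longleftrightarrow>
     (\<forall>x\<in>set xs. \<exists>X\<subseteq>A. indep X \<and> x = code A X) \<and>
     (\<forall>X\<subseteq>A. indep X \<longrightarrow> (\<exists>x\<in>set xs. eqv n (code A X) x)) \<and>
     sorted_wrt (\<lambda>x y. \<not> eqv n y x) xs"

definition singleton_list :: "nat \<Rightarrow> (nat \<Rightarrow> nat) list" where
  "singleton_list v = [code {v} {}, code {v} {v}]"

lemma adj_sym: "adj u v \<Longrightarrow> adj v u"
  by (auto simp: adj_def insert_commute)

lemma adj_irrefl: "\<not> adj u u"
  using graph by (auto simp: adj_def simple_graph_def)

lemma adj_less: "adj u v \<Longrightarrow> u < n \<and> v < n"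
  using graph by (auto simp: adj_def simple_graph_def)

lemma indep_Un: "indep (X \<union> Y) \<longleftrightarrow> indep X \<and> indep Y \<and> (\<forall>x\<in>X. \<forall>y\<in>Y. \<not> adj x y)"
  unfolding indep_def using adj_sym by blast

lemma subset_vertex_cover_iff:
  "subset_vertex_cover {..<n} E T k \<longleftrightarrow> (\<exists>X\<subseteq>{..<n}. indep X \<and> n - card X \<le> k)"
proof
  assume "subset_vertex_cover {..<n} E T k"
  then obtain S where S: "S \<subseteq> {..<n}" "\<forall>e\<in>E. e \<inter> T \<noteq> {} \<longrightarrow> e \<inter> S \<noteq> {}" "card S \<le> k"
    by (auto simp: subset_vertex_cover_def T_vertex_cover_def)
  have "indep ({..<n} - S)" using S(2) by (fastforce simp: indep_def adj_def)
  moreover have "n - card ({..<n} - S) \<le> k"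
  proof -
    have "card ({..<n} - S) = n - card S"
      using card_Diff_subset[OF finite_subset[OF S(1)] S(1)] by simp
    then show ?thesis using S(3) by linarith
  qed
  ultimately show "\<exists>X\<subseteq>{..<n}. indep X \<and> n - card X \<le> k"
    by (intro exI[of _ "{..<n} - S"]) simp
next
  assume "\<exists>X\<subseteq>{..<n}. indep X \<and> n - card X \<le> k"
  then obtain X where X: "X \<subseteq> {..<n}" "indep X" "n - card X \<le> k" by blast
  have "e \<inter> ({..<n} - X) \<noteq> {}" if e: "e \<in> E" "e \<inter> T \<noteq> {}" for e
  proof
    assume "e \<inter> ({..<n} - X) = {}"
    moreover obtain u v where "e = {u, v}" "e \<subseteq> {..<n}"
      using e(1) graph unfolding simple_graph_def card_2_iff by metis
    ultimately have "u \<in> X" "v \<in> X" "adj u v" using e by (auto simp: adj_def)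
    then show False using X by (auto simp: indep_def)
  qed
  then have "T_vertex_cover {..<n} E T ({..<n} - X)" by (auto simp: T_vertex_cover_def)
  moreover have "card ({..<n} - X) \<le> k"
    using X(3) card_Diff_subset[OF finite_subset[OF X(1)] X(1)] by simp
  ultimately show "subset_vertex_cover {..<n} E T k" by (auto simp: subset_vertex_cover_def)
qed

lemma weight_code:
  assumes "X \<subseteq> A" "A \<subseteq> {..<n}"
  shows "weight n (code A X) = card X"
proof -
  have "weight n (code A X) = (\<Sum>u<n. of_bool (u \<in> X))"
    unfolding weight_def by (intro sum.cong) (use assms in \<open>auto simp: code_def\<close>)
  also have "\<dots> = card X" using assms by (simp add: Int_absorb1)
  finally show ?thesis .
qed

text \<open>Inside \<open>A\<close> two entries sum to at least 4; outside, the sum is 1 iff exactly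
  one of the two sets has \<open>u\<close> as a neighbour.\<close>

lemma code_plus_code_eq_1:
  assumes "X \<subseteq> A" "Y \<subseteq> A"
  shows "(\<forall>u. code A X u + code A Y u \<noteq> 1) \<longleftrightarrow> nbrs_outside A X = nbrs_outside A Y"
  unfolding nbrs_outside_def set_eq_iff mem_Collect_eq using assms
  by (intro all_cong1) (auto simp: code_def)

lemma eqv_code:
  assumes "X \<subseteq> A" "Y \<subseteq> A" "A \<subseteq> {..<n}"
  shows "eqv n (code A X) (code A Y) \<longleftrightarrow> nbrs_outside A X = nbrs_outside A Y \<and> card X = card Y"
  using code_plus_code_eq_1[OF assms(1,2)] weight_code assms unfolding eqv_def by auto

text \<open>By disjointness an entry 2 or 3 of one vector meets only 0 or 1 in the other, so the sum
  4 can only be 3 + 1.\<close>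

lemma conflict_code:
  assumes "X \<subseteq> A" "Y \<subseteq> B" "A \<inter> B = {}"
  shows "conflict (code A X) (code B Y) \<longleftrightarrow> (\<exists>x\<in>X. \<exists>y\<in>Y. adj x y)"
proof
  assume "conflict (code A X) (code B Y)"
  then obtain u where "code A X u + code B Y u = 4" by (auto simp: conflict_def)
  then have "u \<in> X \<and> (\<exists>y\<in>Y. adj y u) \<or> u \<in> Y \<and> (\<exists>x\<in>X. adj x u)"
    using assms by (auto simp: code_def split: if_splits)
  then show "\<exists>x\<in>X. \<exists>y\<in>Y. adj x y" using adj_sym by blast
next
  assume "\<exists>x\<in>X. \<exists>y\<in>Y. adj x y"
  then obtain x y where "x \<in> X" "y \<in> Y" "adj x y" by blast
  moreover have "adj y x" using \<open>adj x y\<close> by (rule adj_sym)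
  ultimately have "code A X x + code B Y x = 4" using assms by (auto simp: code_def)
  then show "conflict (code A X) (code B Y)" by (auto simp: conflict_def)
qed

text \<open>The inner entries 2 and 3 of one vector beat the outer entries 0 and 1 of the other;
  outside both sets the maximum is a disjunction.\<close>

lemma merge_code:
  assumes "X \<subseteq> A" "Y \<subseteq> B" "A \<inter> B = {}"
  shows "merge (code A X) (code B Y) = code (A \<union> B) (X \<union> Y)"
  unfolding merge_def code_def using assms by (intro ext) auto

lemma card_nbrs_outside:
  assumes "A \<subseteq> {..<n}"
  shows "finite (nbrs_outside A ` {X. X \<subseteq> A})"
    "card (nbrs_outside A ` {X. X \<subseteq> A}) \<le> (n + 1) ^ (2 * mim {..<n} E A)"
proof -
  let ?w = "mim {..<n} E A"
  let ?S = "{R. R \<subseteq> {..<n} \<and> card R \<le> 2 * ?w}"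
  have "nbrs_outside A X \<in> nbrs_outside A ` ?S" if X: "X \<subseteq> A" for X
  proof -
    obtain R where R: "R \<subseteq> X" "R \<subseteq> T" "card R \<le> ?w"
      "\<forall>q\<in>{..<n} - A. (\<exists>x\<in>X \<inter> T. {x, q} \<in> E) \<longleftrightarrow> (\<exists>x\<in>R. {x, q} \<in> E)"
      using neighbourhood_representative[OF graph le_infI1[OF X, of T] assms order.refl] by auto
    obtain R' where R': "R' \<subseteq> X" "card R' \<le> ?w"
      "\<forall>q\<in>({..<n} - A) \<inter> T. (\<exists>x\<in>X. {x, q} \<in> E) \<longleftrightarrow> (\<exists>x\<in>R'. {x, q} \<in> E)"
      using neighbourhood_representative[OF graph X assms, of "({..<n} - A) \<inter> T"] by auto
    have "nbrs_outside A X \<subseteq> nbrs_outside A (R \<union> R')"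
    proof
      fix u assume "u \<in> nbrs_outside A X"
      then obtain x where x: "x \<in> X" "u \<notin> A" "adj x u" by (auto simp: nbrs_outside_def)
      then have u: "u \<in> {..<n} - A" using adj_less by auto
      show "u \<in> nbrs_outside A (R \<union> R')"
      \<comment> \<open>If \<open>x\<close> is in \<open>T\<close>, then \<open>R\<close> sees
        \<open>u\<close>, and \<open>R \<subseteq> T\<close> makes the edge found an
        \<open>H\<close>-edge. Otherwise \<open>u\<close> is in \<open>T\<close>, \<open>R'\<close>
        sees it, and \<open>u\<close> itself makes the edge an \<open>H\<close>-edge.\<close>
      proof (cases "x \<in> T")
        case True
        then have "\<exists>x\<in>X \<inter> T. {x, u} \<in> E" using x by (auto simp: adj_def)
        then obtain r where "r \<in> R" "{r, u} \<in> E" using R(4) u by blast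
        then show ?thesis using R(2) x(2) by (auto simp: nbrs_outside_def adj_def)
      next
        case False
        then have "u \<in> T" "\<exists>x\<in>X. {x, u} \<in> E" using x by (auto simp: adj_def)
        then obtain r where "r \<in> R'" "{r, u} \<in> E" using R'(3) u by blast
        then show ?thesis using \<open>u \<in> T\<close> x(2) by (auto simp: nbrs_outside_def adj_def)
      qed
    qed
    moreover have "nbrs_outside A (R \<union> R') \<subseteq> nbrs_outside A X"
      using R(1) R'(1) by (auto simp: nbrs_outside_def)
    moreover have "R \<union> R' \<in> ?S"
      using R R' X assms card_Un_le[of R R'] by auto
    ultimately show ?thesis by blast
  qed
  then have sub: "nbrs_outside A ` {X. X \<subseteq> A} \<subseteq> nbrs_outside A ` ?S" by blast
  show "finite (nbrs_outside A ` {X. X \<subseteq> A})"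
    using finite_subset[OF sub] card_small_subsets(1) by blast
  show "card (nbrs_outside A ` {X. X \<subseteq> A}) \<le> (n + 1) ^ (2 * ?w)"
    using surj_card_le[OF card_small_subsets(1) sub] card_small_subsets(2) order.trans by blast
qed

text \<open>Inequivalent candidates differ in outer neighbourhood or cardinality. There are at most
  \<open>n + 1\<close> cardinalities, hence the extra 1 in the exponent.\<close>

lemma length_represents:
  assumes "represents A xs" "A \<subseteq> {..<n}"
  shows "length xs \<le> (n + 1) ^ (2 * mim {..<n} E A + 1)"
proof -
  define key where "key x = ({u. x u = 1}, weight n x)" for x
  have key: "key (code A X) = (nbrs_outside A X, card X)" if "X \<subseteq> A" for X
    using weight_code[OF that assms(2)] that by (auto simp: key_def nbrs_outside_def code_def)
  have sound: "\<exists>X\<subseteq>A. x = code A X" if "x \<in> set xs" for x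
  proof -
    have "\<forall>x\<in>set xs. \<exists>X\<subseteq>A. indep X \<and> x = code A X" using assms(1) by (simp add: represents_def)
    then show ?thesis using that by blast
  qed
  have "sorted_wrt (\<lambda>x y. \<not> eqv n y x) xs" using assms(1) by (simp add: represents_def)
  moreover have "\<not> eqv n y x \<Longrightarrow> key x \<noteq> key y" if xy: "x \<in> set xs" "y \<in> set xs" for x y
    using sound[OF xy(1)] sound[OF xy(2)] assms(2) by (auto simp: key eqv_code)
  ultimately have "sorted_wrt (\<lambda>x y. key x \<noteq> key y) xs"
    by (rule sorted_wrt_mono_rel[rotated])
  then have "key (xs ! i) \<noteq> key (xs ! j)" if "i < j" "j < length xs" for i j
    using that by (simp add: sorted_wrt_iff_nth_less)
  then have "key (xs ! i) \<noteq> key (xs ! j)" if "i \<noteq> j" "i < length xs" "j < length xs" for i j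
    using that by (metis nat_neq_iff)
  then have "distinct (map key xs)" by (simp add: distinct_conv_nth)
  then have len: "length xs = card (key ` set xs)" using distinct_card by fastforce
  have "key ` set xs \<subseteq> nbrs_outside A ` {X. X \<subseteq> A} \<times> {..n}"
  proof (rule image_subsetI)
    fix x assume "x \<in> set xs"
    then obtain X where X: "X \<subseteq> A" "x = code A X" using sound by blast
    have "card X \<le> n" using card_mono[of "{..<n}" X] X assms(2) by auto
    then show "key x \<in> nbrs_outside A ` {X. X \<subseteq> A} \<times> {..n}" using X key by auto
  qed
  then have "length xs \<le> card (nbrs_outside A ` {X. X \<subseteq> A} \<times> {..n})"
    unfolding len using card_nbrs_outside(1)[OF assms(2)] by (intro card_mono) auto
  also have "\<dots> \<le> (n + 1) ^ (2 * mim {..<n} E A + 1)"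
    using mult_le_mono1[OF card_nbrs_outside(2)[OF assms(2)], of "n + 1"]
    by (simp add: card_cartesian_product mult.commute)
  finally show ?thesis .
qed

lemma represents_singleton:
  assumes "v < n"
  shows "represents {v} (singleton_list v)"
proof -
  have sub: "X \<subseteq> {v} \<longleftrightarrow> X = {} \<or> X = {v}" for X by auto
  have i: "indep {}" "indep {v}" by (auto simp: indep_def adj_irrefl)
  have "eqv n (code {v} X) (code {v} X)" if "X \<subseteq> {v}" for X
    using eqv_code[of X "{v}" X] that assms by auto
  moreover have "\<not> eqv n (code {v} {v}) (code {v} {})"
    using eqv_code[of "{v}" "{v}" "{}"] assms by auto
  ultimately show ?thesis using i
    unfolding represents_def singleton_list_def sub by auto
qed

text \<open>Completeness is an exchange argument: the parts of \<open>Z\<close> in \<open>A\<close>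
  and in \<open>B\<close> are replaced one after the other by stored candidates with the same outer
  neighbours and the same size.\<close>

lemma represents_join:
  assumes A: "represents A xs" "A \<subseteq> {..<n}" and B: "represents B ys" "B \<subseteq> {..<n}" and disj: "A \<inter> B = {}"
  shows "represents (A \<union> B) (join n xs ys)"
proof -
  let ?C = "A \<union> B"
  have C: "?C \<subseteq> {..<n}" using A B by auto
  have sound: "\<exists>X Y. X \<subseteq> A \<and> Y \<subseteq> B \<and> indep X \<and> indep Y \<and> x = code A X \<and> y = code B Y"
    if "x \<in> set xs" "y \<in> set ys" for x y
  proof -
    have "\<exists>X\<subseteq>A. indep X \<and> x = code A X" "\<exists>Y\<subseteq>B. indep Y \<and> y = code B Y"
      using A(1) B(1) that by (simp_all add: represents_def)
    then show ?thesis by blast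
  qed
  have "(\<forall>z\<in>set (join n xs ys). \<exists>Z\<subseteq>?C. indep Z \<and> z = code ?C Z) \<and>
        sorted_wrt (\<lambda>x y. \<not> eqv n y x) (join n xs ys)"
  proof (rule join_invariant)
    fix x y zs
    assume xy: "x \<in> set xs" "y \<in> set ys" and
      zs: "(\<forall>z\<in>set zs. \<exists>Z\<subseteq>?C. indep Z \<and> z = code ?C Z) \<and> sorted_wrt (\<lambda>x y. \<not> eqv n y x) zs"
    obtain X Y where XY: "X \<subseteq> A" "Y \<subseteq> B" "indep X" "indep Y" "x = code A X" "y = code B Y"
      using sound[OF xy] by blast
    have "\<not> conflict x y \<Longrightarrow> indep (X \<union> Y) \<and> merge x y = code ?C (X \<union> Y)"
      using XY disj by (auto simp: conflict_code merge_code indep_Un)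
    moreover have "X \<union> Y \<subseteq> ?C" using XY(1,2) by blast
    ultimately have "\<not> conflict x y \<Longrightarrow> \<exists>Z\<subseteq>?C. indep Z \<and> merge x y = code ?C Z" by blast
    then show "(\<forall>z\<in>set (join_one n x y zs). \<exists>Z\<subseteq>?C. indep Z \<and> z = code ?C Z) \<and>
        sorted_wrt (\<lambda>x y. \<not> eqv n y x) (join_one n x y zs)"
      using zs unfolding join_one_def by (simp add: sorted_wrt_append)
  qed auto
  then have sound_join: "\<forall>z\<in>set (join n xs ys). \<exists>Z\<subseteq>?C. indep Z \<and> z = code ?C Z"
    and sorted: "sorted_wrt (\<lambda>x y. \<not> eqv n y x) (join n xs ys)" by simp_all
  have "\<exists>z\<in>set (join n xs ys). eqv n (code ?C Z) z" if Z: "Z \<subseteq> ?C" "indep Z" for Z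
  proof -
    define P Q where "P = Z \<inter> A" and "Q = Z \<inter> B"
    have PQ: "P \<subseteq> A" "Q \<subseteq> B" "Z = P \<union> Q" using Z by (auto simp: P_def Q_def)
    have ind: "indep P" "indep Q" "\<forall>x\<in>P. \<forall>y\<in>Q. \<not> adj x y" using Z(2) unfolding PQ(3) indep_Un by auto
    obtain x where x: "x \<in> set xs" "eqv n (code A P) x"
      using A PQ ind unfolding represents_def by blast
    obtain y where y: "y \<in> set ys" "eqv n (code B Q) y"
      using B PQ ind unfolding represents_def by blast
    obtain X Y where XY: "X \<subseteq> A" "Y \<subseteq> B" "indep X" "indep Y" "x = code A X" "y = code B Y"
      using sound[OF x(1) y(1)] by blast
    have X: "nbrs_outside A P = nbrs_outside A X" "card P = card X"
      using x XY PQ A by (auto simp: eqv_code)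
    have Y: "nbrs_outside B Q = nbrs_outside B Y" "card Q = card Y"
      using y XY PQ B by (auto simp: eqv_code)
    have nX: "(\<exists>p\<in>P. adj p u) \<longleftrightarrow> (\<exists>p\<in>X. adj p u)" if "u \<notin> A" for u
      using X(1) that by (auto simp: nbrs_outside_def set_eq_iff)
    have nY: "(\<exists>p\<in>Q. adj p u) \<longleftrightarrow> (\<exists>p\<in>Y. adj p u)" if "u \<notin> B" for u
      using Y(1) that by (auto simp: nbrs_outside_def set_eq_iff)
    \<comment> \<open>First \<open>P\<close> is exchanged for \<open>X\<close> against the unchanged
      \<open>Q\<close>, which lies outside \<open>A\<close>; then \<open>Q\<close> for
      \<open>Y\<close> against \<open>X\<close>, which lies outside \<open>B\<close>.\<close>
    have "\<not> adj p q" if "p \<in> X" "q \<in> Q" for p q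
      using nX[of q] ind(3) that PQ(2) disj by blast
    then have no: "\<not> adj p q" if "p \<in> X" "q \<in> Y" for p q
      using nY[of p] that XY(1) disj adj_sym by blast
    have ncon: "\<not> conflict x y" using no XY disj by (auto simp: conflict_code)
    have fin: "finite P" "finite Q" "finite X" "finite Y"
      using PQ XY A(2) B(2) by (meson finite_subset finite_lessThan)+
    have "P \<inter> Q = {}" "X \<inter> Y = {}" using PQ XY disj by blast+
    then have "card Z = card (X \<union> Y)"
      using card_Un_disjoint[OF fin(1,2)] card_Un_disjoint[OF fin(3,4)] PQ(3) X(2) Y(2) by auto
    moreover have "nbrs_outside ?C Z = nbrs_outside ?C (X \<union> Y)"
      unfolding PQ(3) nbrs_outside_def set_eq_iff mem_Collect_eq bex_Un using nX nY
      by (simp cong: conj_cong)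
    ultimately have e: "nbrs_outside ?C Z = nbrs_outside ?C (X \<union> Y)" "card Z = card (X \<union> Y)" by auto
    have sub: "X \<union> Y \<subseteq> ?C" using XY by auto
    have m: "merge x y = code ?C (X \<union> Y)" using XY disj by (simp add: merge_code)
    obtain z where z: "z \<in> set (join n xs ys)" "z = merge x y \<or> eqv n (merge x y) z"
      using join_covers[OF x(1) y(1) ncon] by blast
    obtain W where W: "W \<subseteq> ?C" "z = code ?C W" using bspec[OF sound_join z(1)] by blast
    \<comment> \<open>Transitivity is obtained through \<open>eqv_code\<close>, where equivalence
      becomes equality of neighbourhoods and cardinalities.\<close>
    have "eqv n (code ?C Z) z"
      using z(2) unfolding W(2) m
    proof
      assume "code ?C W = code ?C (X \<union> Y)"
      then show "eqv n (code ?C Z) (code ?C W)" using eqv_code[OF Z(1) sub C] e by simp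
    next
      assume "eqv n (code ?C (X \<union> Y)) (code ?C W)"
      then show "eqv n (code ?C Z) (code ?C W)"
        using eqv_code[OF Z(1) W(1) C] eqv_code[OF sub W(1) C] e by simp
    qed
    then show ?thesis using z(1) by blast
  qed
  then show ?thesis using sound_join sorted unfolding represents_def by simp
qed

text \<open>One step in the evaluation of a postfix expression. The right subtree was pushed last,
  so its table is \<open>st ! 0\<close>.\<close>

definition push_token :: "nat \<Rightarrow> (nat \<Rightarrow> nat) list list \<Rightarrow> (nat \<Rightarrow> nat) list list" where
  "push_token tok st =
     (if tok = 0 then join n (st ! 1) (st ! 0) # drop 2 st else singleton_list (tok - 1) # st)"

text \<open>What the machine relies on at every token. The lengths matter because they become loop
  counters.\<close>

primrec safe :: "nat \<Rightarrow> (nat \<Rightarrow> nat) list list \<Rightarrow> nat list \<Rightarrow> bool" where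
  "safe B st [] = True"
| "safe B st (tok # toks) \<longleftrightarrow> (tok = 0 \<longrightarrow> 2 \<le> length st) \<and> tok \<le> n \<and>
     (\<forall>xs\<in>set (push_token tok st). length xs \<le> B) \<and> safe B (push_token tok st) toks"

lemma safe_nth:
  assumes "safe B st toks" "i < length toks"
  shows "(toks ! i = 0 \<longrightarrow> 2 \<le> length (fold push_token (take i toks) st)) \<and> toks ! i \<le> n \<and>
    (\<forall>xs\<in>set (push_token (toks ! i) (fold push_token (take i toks) st)). length xs \<le> B)"
  using assms
proof (induction toks arbitrary: st i)
  case (Cons tok toks)
  then show ?case by (cases i) auto
qed simp

end

section \<open>Tables along the layout\<close>

locale svc_layout = svc_instance +
  fixes L :: btree and \<delta> :: "nat \<Rightarrow> bool list"
  assumes layout: "rooted_layout {..<n} L \<delta>"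
begin

text \<open>Expresses that \<open>t\<close> hangs at position \<open>x\<close> of \<open>L\<close>
  by two facts: the first determines the vertices below \<open>x\<close>, the second makes the mim
  at \<open>x\<close> count in \<open>layout_mim\<close>.\<close>

definition subtree_at :: "bool list \<Rightarrow> btree \<Rightarrow> bool" where
  "subtree_at x t \<longleftrightarrow> {\<delta> v |v. v < n \<and> prefix x (\<delta> v)} = (@) x ` leaves t \<and> (@) x ` nodes t \<subseteq> nodes L"

primrec table :: "btree \<Rightarrow> bool list \<Rightarrow> (nat \<Rightarrow> nat) list" where
  "table Leaf x = singleton_list (the_inv_into {..<n} \<delta> x)"
| "table (Node l r) x = join n (table l (x @ [False])) (table r (x @ [True]))"

lemma subtree_at_root: "subtree_at [] L"
  using layout by (auto simp: subtree_at_def rooted_layout_def bij_betw_def)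

lemma subtree_at_Node:
  assumes "subtree_at x (Node l r)"
  shows "subtree_at (x @ [False]) l" "subtree_at (x @ [True]) r"
proof -
  have *: "\<delta> v \<in> (\<lambda>p. x @ False # p) ` leaves l \<union> (\<lambda>p. x @ True # p) ` leaves r"
    if "v < n" "prefix x (\<delta> v)" for v
  proof -
    have "\<delta> v \<in> (@) x ` leaves (Node l r)" using assms that unfolding subtree_at_def by blast
    then show ?thesis by auto
  qed
  have **: "\<exists>v<n. \<delta> v = x @ p" if "p \<in> leaves (Node l r)" for p
  proof -
    have "x @ p \<in> {\<delta> v |v. v < n \<and> prefix x (\<delta> v)}" using assms that unfolding subtree_at_def by blast
    then show ?thesis by auto
  qed
  have "{\<delta> v |v. v < n \<and> prefix (x @ [False]) (\<delta> v)} = (@) (x @ [False]) ` leaves l"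
  proof (intro equalityI subsetI)
    fix p assume "p \<in> {\<delta> v |v. v < n \<and> prefix (x @ [False]) (\<delta> v)}"
    then obtain v where v: "p = \<delta> v" "v < n" "prefix (x @ [False]) (\<delta> v)" by blast
    then show "p \<in> (@) (x @ [False]) ` leaves l"
      using *[OF v(2) append_prefixD[OF v(3)]] by auto
  next
    fix p assume "p \<in> (@) (x @ [False]) ` leaves l"
    then obtain q where "p = x @ False # q" "q \<in> leaves l" by auto
    then show "p \<in> {\<delta> v |v. v < n \<and> prefix (x @ [False]) (\<delta> v)}"
      using **[of "False # q"] by force
  qed
  moreover have "{\<delta> v |v. v < n \<and> prefix (x @ [True]) (\<delta> v)} = (@) (x @ [True]) ` leaves r"
  proof (intro equalityI subsetI)
    fix p assume "p \<in> {\<delta> v |v. v < n \<and> prefix (x @ [True]) (\<delta> v)}"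
    then obtain v where v: "p = \<delta> v" "v < n" "prefix (x @ [True]) (\<delta> v)" by blast
    then show "p \<in> (@) (x @ [True]) ` leaves r"
      using *[OF v(2) append_prefixD[OF v(3)]] by auto
  next
    fix p assume "p \<in> (@) (x @ [True]) ` leaves r"
    then obtain q where "p = x @ True # q" "q \<in> leaves r" by auto
    then show "p \<in> {\<delta> v |v. v < n \<and> prefix (x @ [True]) (\<delta> v)}"
      using **[of "True # q"] by force
  qed
  ultimately show "subtree_at (x @ [False]) l" "subtree_at (x @ [True]) r"
    using assms by (auto simp: subtree_at_def)
qed

lemma below_Leaf:
  assumes "subtree_at x Leaf"
  shows "the_inv_into {..<n} \<delta> x < n" "below {..<n} \<delta> x = {the_inv_into {..<n} \<delta> x}"
proof -
  have inj: "inj_on \<delta> {..<n}" using layout by (simp add: rooted_layout_def bij_betw_def)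
  have *: "{\<delta> v |v. v < n \<and> prefix x (\<delta> v)} = {x}" using assms by (simp add: subtree_at_def)
  then have "x \<in> {\<delta> v |v. v < n \<and> prefix x (\<delta> v)}" by simp
  then obtain v where v: "v < n" "\<delta> v = x" by blast
  have eq: "the_inv_into {..<n} \<delta> x = v" using the_inv_into_f_f[OF inj, of v] v by simp
  have uniq: "w = v" if "w < n" "prefix x (\<delta> w)" for w
  proof -
    have "\<delta> w \<in> {\<delta> v |v. v < n \<and> prefix x (\<delta> v)}" using that by blast
    then have "\<delta> w = \<delta> v" using * v by simp
    then show ?thesis using inj_onD[OF inj] v that by simp
  qed
  show "the_inv_into {..<n} \<delta> x < n" using v(1) eq by simp
  have "prefix x (\<delta> v)" using v(2) by simp
  then show "below {..<n} \<delta> x = {the_inv_into {..<n} \<delta> x}"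
    unfolding eq below_def using v(1) uniq by blast
qed

lemma below_Node:
  assumes "subtree_at x (Node l r)"
  shows "below {..<n} \<delta> x = below {..<n} \<delta> (x @ [False]) \<union> below {..<n} \<delta> (x @ [True])"
    "below {..<n} \<delta> (x @ [False]) \<inter> below {..<n} \<delta> (x @ [True]) = {}"
proof -
  have "prefix (x @ [False]) (\<delta> v) \<or> prefix (x @ [True]) (\<delta> v)" if "v < n" "prefix x (\<delta> v)" for v
  proof -
    have "\<delta> v \<in> (@) x ` leaves (Node l r)" using assms that unfolding subtree_at_def by blast
    then show ?thesis by auto
  qed
  then show "below {..<n} \<delta> x = below {..<n} \<delta> (x @ [False]) \<union> below {..<n} \<delta> (x @ [True])"
    by (auto simp: below_def dest: append_prefixD)
  show "below {..<n} \<delta> (x @ [False]) \<inter> below {..<n} \<delta> (x @ [True]) = {}"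
    by (auto simp: below_def prefix_def)
qed

lemma below_subset: "below {..<n} \<delta> x \<subseteq> {..<n}"
  by (auto simp: below_def)

lemma represents_table: "subtree_at x t \<Longrightarrow> represents (below {..<n} \<delta> x) (table t x)"
proof (induction t arbitrary: x)
  case Leaf
  then show ?case using below_Leaf represents_singleton by simp
next
  case (Node l r)
  then show ?case
    using represents_join[OF Node.IH(1) below_subset Node.IH(2) below_subset] subtree_at_Node[OF Node.prems]
      below_Node[OF Node.prems] by simp
qed

lemma root_in_nodes: "[] \<in> nodes t"
  by (cases t) auto

lemma finite_nodes: "finite (nodes t)"
  by (induction t) auto

lemma length_table:
  assumes "subtree_at x t"
  shows "length (table t x) \<le> (n + 1) ^ (2 * layout_mim {..<n} E L \<delta> + 1)"
proof -
  have "x \<in> nodes L" using assms root_in_nodes[of t] unfolding subtree_at_def by force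
  then have "mim {..<n} E (below {..<n} \<delta> x) \<le> layout_mim {..<n} E L \<delta>"
    unfolding layout_mim_def by (intro Max_ge) (auto simp: finite_nodes)
  then have "(n + 1) ^ (2 * mim {..<n} E (below {..<n} \<delta> x) + 1) \<le> (n + 1) ^ (2 * layout_mim {..<n} E L \<delta> + 1)"
    by (intro power_increasing) auto
  then show ?thesis
    using length_represents[OF represents_table[OF assms] below_subset] by linarith
qed

lemma fold_encode_layout:
  "fold push_token (encode_layout {..<n} \<delta> x t) st = table t x # st"
  by (induction t arbitrary: x st) (auto simp: push_token_def)

text \<open>The rest \<open>toks\<close> is a continuation: the code of a left subtree is followed
  by that of the right one and by 0.\<close>

lemma safe_encode_layout:
  assumes "subtree_at x t" "\<forall>xs\<in>set st. length xs \<le> B" "(n + 1) ^ (2 * layout_mim {..<n} E L \<delta> + 1) \<le> B"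
    "safe B (table t x # st) toks"
  shows "safe B st (encode_layout {..<n} \<delta> x t @ toks)"
  using assms(1,2,4)
proof (induction t arbitrary: x st toks)
  case Leaf
  then show ?case
    using below_Leaf[OF Leaf(1)] length_table[OF Leaf(1)] assms(3) by (auto simp: push_token_def)
next
  case (Node l r)
  note at = subtree_at_Node[OF Node.prems(1)]
  have len: "length (table l (x @ [False])) \<le> B" "length (table (Node l r) x) \<le> B"
    using length_table at Node.prems(1) assms(3) order.trans by blast+
  have "safe B (table r (x @ [True]) # table l (x @ [False]) # st) (0 # toks)"
    using Node.prems len by (simp add: push_token_def)
  then show ?case
    using Node.IH(1)[OF at(1) Node.prems(2)] Node.IH(2)[OF at(2), of "table l (x @ [False]) # st"]
      Node.prems(2) len by simp
qed

lemma finite_leaves: "finite (leaves t)"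
  by (induction t) auto

text \<open>A binary tree with \<open>n\<close> leaves has \<open>2 * n - 1\<close> nodes, so the
  machine can compute the number of tokens from \<open>n\<close>.\<close>

lemma length_encode_layout: "length (encode_layout V \<delta> x t) + 1 = 2 * card (leaves t)"
proof (induction t arbitrary: x)
  case (Node l r)
  have "card (leaves (Node l r)) = card ((#) False ` leaves l) + card ((#) True ` leaves r)"
    unfolding leaves.simps by (intro card_Un_disjoint) (auto simp: finite_leaves)
  also have "\<dots> = card (leaves l) + card (leaves r)" by (simp add: card_image)
  finally show ?case using Node[of "x @ [False]"] Node[of "x @ [True]"] by simp
qed simp

lemma card_leaves: "card (leaves L) = n"
  using layout bij_betw_same_card unfolding rooted_layout_def by fastforce

text \<open>Every \<open>btree\<close> has a leaf, so the empty graph has no layout.\<close>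

lemma n_pos: "0 < n"
proof -
  have "leaves L \<noteq> {}" by (induction L) auto
  then show ?thesis using card_leaves finite_leaves[of L] card_gt_0_iff by metis
qed

lemma represents_root: "represents {..<n} (table L [])"
  using represents_table[OF subtree_at_root] by (simp add: below_def lessThan_def)

end

section \<open>The machine program\<close>

lemma wp_frame:
  assumes "wp B c (\<lambda>R' M'. (\<forall>x. x \<notin> writes c \<longrightarrow> R' x = R x) \<longrightarrow> Q R' M') R M"
  shows "wp B c Q R M"
  using assms run_unwritten[of _ c "(R, M)"] by (simp add: wp_def)

definition inc :: "nat \<Rightarrow> com" where
  "inc r = Instr (Const 2 1) ;; Instr (Add r r 2)"

definition mov :: "nat \<Rightarrow> nat \<Rightarrow> com" where
  "mov r a = Instr (Const r 0) ;; Instr (Add r r a)"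

text \<open>One of the two truncated differences is 0, so their sum is the distance of
  \<open>s\<close> and \<open>k\<close>; subtracting it from 1 gives the truth value.\<close>

definition is_eq :: "nat \<Rightarrow> nat \<Rightarrow> nat \<Rightarrow> com" where
  "is_eq d s k = Instr (Const 18 k) ;; Instr (Sub d s 18) ;; Instr (Sub 18 18 s) ;;
     Instr (Add d d 18) ;; Instr (Const 18 1) ;; Instr (Sub d 18 d)"

lemma wp_macros [simp]:
  "r \<noteq> 2 \<Longrightarrow> wp B (inc r) Q R M = Q (R(2 := 1, r := R r + 1)) M"
  "r \<noteq> a \<Longrightarrow> wp B (mov r a) Q R M = Q (R(r := R a)) M"
  "d \<noteq> 18 \<Longrightarrow> s \<noteq> 18 \<Longrightarrow> d \<noteq> s \<Longrightarrow>
     wp B (is_eq d s k) Q R M = Q (R(18 := 1, d := of_bool (R s = k))) M"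
proof -
  assume "d \<noteq> 18" "s \<noteq> 18" "d \<noteq> s"
  then have "R(18 := 1, d := 1 - (R s - k + (k - R s))) = R(18 := 1, d := of_bool (R s = k))"
    by (auto simp: fun_eq_iff)
  then show "wp B (is_eq d s k) Q R M = Q (R(18 := 1, d := of_bool (R s = k))) M"
    using \<open>d \<noteq> 18\<close> \<open>s \<noteq> 18\<close> \<open>d \<noteq> s\<close> by (simp add: is_eq_def fun_upd_twist)
qed (simp_all add: inc_def mov_def)

lemma writes_macros [simp]:
  "writes (inc r) = {2, r}" "writes (mov r a) = {r}" "writes (is_eq d s k) = {18, d}"
  by (auto simp: inc_def mov_def is_eq_def)

lemma wf_macros [simp]: "wf_com (inc r)" "wf_com (mov r a)" "wf_com (is_eq d s k)"
  by (auto simp: inc_def mov_def is_eq_def)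

text \<open>The value 0 from \<open>n\<close> on agrees with \<open>code\<close> for sets of
  vertices, so stored vectors equal code vectors as total functions.\<close>

definition vec :: "nat \<Rightarrow> (nat \<Rightarrow> nat) \<Rightarrow> nat \<Rightarrow> nat \<Rightarrow> nat" where
  "vec n M p = (\<lambda>u. if u < n then M (p + u) else 0)"

definition vecs :: "nat \<Rightarrow> (nat \<Rightarrow> nat) \<Rightarrow> nat \<Rightarrow> nat \<Rightarrow> (nat \<Rightarrow> nat) list" where
  "vecs n M p c = map (\<lambda>i. vec n M (p + i * n)) [0..<c]"

lemma length_vecs [simp]: "length (vecs n M p c) = c"
  by (simp add: vecs_def)

lemma nth_vecs [simp]: "i < c \<Longrightarrow> vecs n M p c ! i = vec n M (p + i * n)"
  by (simp add: vecs_def)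

lemma vecs_0 [simp]: "vecs n M p 0 = []"
  by (simp add: vecs_def)

lemma vecs_Suc: "vecs n M p (Suc c) = vecs n M p c @ [vec n M (p + c * n)]"
  by (simp add: vecs_def)

lemma vecs_cong:
  assumes "\<And>a. p \<le> a \<Longrightarrow> a < p + c * n \<Longrightarrow> M' a = M a"
  shows "vecs n M' p c = vecs n M p c"
  unfolding vecs_def
proof (rule map_cong[OF refl])
  fix i assume "i \<in> set [0..<c]"
  then have "Suc i * n \<le> c * n" by (intro mult_le_mono1) auto
  then show "vec n M' (p + i * n) = vec n M (p + i * n)"
    using assms by (auto simp: vec_def)
qed

section \<open>Loops over vectors and lists of vectors\<close>

text \<open>
  Register usage: 0 result; 2, 13 to 18 scratch; 3 \<open>n\<close>; 4 \<open>k\<close>; 5 address of \<open>T\<close>; 6 address of the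
  current token; 7 main loop counter; 8 first free cell; 9 top of the stack; 10 token; 11, 12 kind of
  token; 19 left block; 20 address of the length of the output list; 21 address of its next vector;
  22 its length; 23 its address; 24, 25 length and current vector of the left list; 26, 27 length
  and address of the right list; 28, 29 counter and current vector in the right list; 30 to 32
  pointers of the merge loop; 33 number of reasons to drop the merged vector; 34 to 39 comparison
  with the output list; 40 to 47 leaves; 48 number of small covers found.
\<close>

definition merge_loop :: com where
  "merge_loop = mov 30 25 ;; mov 31 29 ;; mov 32 21 ;; Instr (Const 33 0) ;; mov 13 3 ;;
     For 13 (Instr (Load 14 30) ;; Instr (Load 15 31) ;; Instr (Sub 16 15 14) ;; Instr (Add 16 16 14) ;;
       Instr (Store 32 16) ;; Instr (Add 16 14 15) ;; is_eq 17 16 4 ;; Instr (Add 33 33 17) ;;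
       inc 30 ;; inc 31 ;; inc 32) ;;
     mov 29 31"

lemma wp_merge_loop:
  assumes n: "R 3 = n" "n \<le> B" and pos: "R 25 + n \<le> R 21" "R 29 + n \<le> R 21"
    and post: "\<And>R' M'. \<lbrakk>\<forall>a<R 21. M' a = M a;
      vec n M' (R 21) = merge (vec n M (R 25)) (vec n M (R 29));
      R' 33 = 0 \<longleftrightarrow> \<not> conflict (vec n M (R 25)) (vec n M (R 29)); R' 29 = R 29 + n;
      \<And>x. x \<notin> {2, 13, 14, 15, 16, 17, 18, 29, 30, 31, 32, 33} \<Longrightarrow> R' x = R x\<rbrakk> \<Longrightarrow> Q R' M'"
  shows "wp B merge_loop Q R M"
proof -
  define l r q where "l = R 25" and "r = R 29" and "q = R 21"
  note d = l_def[symmetric] r_def[symmetric] q_def[symmetric]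
  \<comment> \<open>The loop forms the maximum without a case distinction.\<close>
  have max: "b - a + a = max a b" for a b :: nat by simp
  show ?thesis
    unfolding merge_loop_def
    apply (simp add: d n(1))
    apply (rule wp_For[where Inv = "\<lambda>i R' M'. R' 30 = l + i \<and> R' 31 = r + i \<and> R' 32 = q + i \<and>
        (\<forall>a<q. M' a = M a) \<and> (\<forall>u<i. M' (q + u) = max (M (l + u)) (M (r + u))) \<and>
        (R' 33 = 0 \<longleftrightarrow> (\<forall>u<i. M (l + u) + M (r + u) \<noteq> 4))"])
    using pos n unfolding d
         apply (simp_all add: max All_less_Suc)
     apply (force)
    apply (rule post)
        apply (auto simp: d vec_def merge_def conflict_def)
    done
qed

lemma weight_vec: "weight n (vec n M p) = (\<Sum>u<n. M (p + u) - 2)"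
  by (simp add: weight_def vec_def)

text \<open>Register 37 collects evidence against equivalence: the number of entries with sum 1 plus
  the distance of the two weights. Its being 0 is a reason to drop the merged vector.\<close>

definition compare_loop :: com where
  "compare_loop = mov 36 21 ;; Instr (Const 37 0) ;; Instr (Const 38 0) ;; Instr (Const 39 0) ;; mov 13 3 ;;
     For 13 (Instr (Load 14 36) ;; Instr (Load 15 35) ;; Instr (Add 16 14 15) ;; is_eq 17 16 1 ;;
       Instr (Add 37 37 17) ;; Instr (Const 16 2) ;; Instr (Sub 14 14 16) ;; Instr (Add 38 38 14) ;;
       Instr (Sub 15 15 16) ;; Instr (Add 39 39 15) ;; inc 36 ;; inc 35) ;;
     Instr (Sub 14 38 39) ;; Instr (Add 37 37 14) ;; Instr (Sub 14 39 38) ;; Instr (Add 37 37 14) ;;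
     is_eq 17 37 0 ;; Instr (Add 33 33 17)"

lemma wp_compare_loop:
  assumes n: "R 3 = n" "n \<le> B"
    and post: "\<And>R'. \<lbrakk>R' 33 = 0 \<longleftrightarrow> R 33 = 0 \<and> \<not> eqv n (vec n M (R 21)) (vec n M (R 35)); R' 35 = R 35 + n;
      \<And>x. x \<notin> {2, 13, 14, 15, 16, 17, 18, 33, 35, 36, 37, 38, 39} \<Longrightarrow> R' x = R x\<rbrakk> \<Longrightarrow> Q R' M"
  shows "wp B compare_loop Q R M"
proof -
  define p q where "p = R 21" and "q = R 35"
  note d = p_def[symmetric] q_def[symmetric]
  have e: "eqv n (vec n M p) (vec n M q) \<longleftrightarrow> (\<forall>u<n. M (p + u) + M (q + u) \<noteq> Suc 0) \<and>
      (\<Sum>u<n. M (p + u) - 2) = (\<Sum>u<n. M (q + u) - 2)"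
    unfolding eqv_def weight_vec by (auto simp: vec_def)
  show ?thesis
    unfolding compare_loop_def
    apply (simp add: d n(1))
    apply (rule wp_For[where Inv = "\<lambda>i R' M'. R' 36 = p + i \<and> R' 35 = q + i \<and> M' = M \<and>
        R' 38 = (\<Sum>u<i. M (p + u) - 2) \<and> R' 39 = (\<Sum>u<i. M (q + u) - 2) \<and>
        (R' 37 = 0 \<longleftrightarrow> (\<forall>u<i. M (p + u) + M (q + u) \<noteq> 1))"])
    using n unfolding d
         apply (simp_all add: All_less_Suc conj_commute)
    subgoal by (simp add: q_def)

    subgoal for R'
      apply (intro conjI impI)
      subgoal by (rule post) (simp_all add: d e)
      subgoal premises prems
        by (rule post) (use prems(1,3-5) in \<open>simp_all add: d e\<close>, use prems(6) in force)
      done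
    done
qed

definition search_loop :: com where
  "search_loop = mov 35 23 ;; mov 34 22 ;; For 34 compare_loop"

lemma writes_compare_loop: "writes compare_loop = {2, 13, 14, 15, 16, 17, 18, 33, 35, 36, 37, 38, 39}"
  unfolding compare_loop_def by auto

lemma wp_search_loop:
  assumes n: "R 3 = n" "n \<le> B" "R 22 \<le> B"
    and post: "\<And>R'. \<lbrakk>R' 33 = 0 \<longleftrightarrow> R 33 = 0 \<and> \<not> (\<exists>z\<in>set (vecs n M (R 23) (R 22)). eqv n (vec n M (R 21)) z);
      \<And>x. x \<notin> {2, 13, 14, 15, 16, 17, 18, 33, 34, 35, 36, 37, 38, 39} \<Longrightarrow> R' x = R x\<rbrakk> \<Longrightarrow> Q R' M"
  shows "wp B search_loop Q R M"
  unfolding search_loop_def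
  apply simp
  apply (rule wp_For[where Inv = "\<lambda>i R' M'. R' 35 = R 23 + i * n \<and> M' = M \<and>
     (R' 33 = 0 \<longleftrightarrow> R 33 = 0 \<and> \<not> (\<exists>z\<in>set (vecs n M (R 23) i). eqv n (vec n M (R 21)) z))"])
  subgoal using n by simp
  subgoal by simp
  subgoal by (simp add: writes_compare_loop)
  subgoal by simp
  subgoal for i R' M'
    apply (rule wp_compare_loop[where n = n])
      apply (use n in \<open>simp_all add: vecs_Suc writes_compare_loop\<close>)
    by auto
  subgoal for R' M'
    apply (simp add: writes_compare_loop)
    apply (rule post)
     apply simp_all
    done
  done

lemma writes_merge_loop: "writes merge_loop = {2, 13, 14, 15, 16, 17, 18, 29, 30, 31, 32, 33}"
  unfolding merge_loop_def by auto

lemma writes_search_loop: "writes search_loop = {2, 13, 14, 15, 16, 17, 18, 33, 34, 35, 36, 37, 38, 39}"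
  unfolding search_loop_def by (auto simp: writes_compare_loop)

text \<open>The merged vector already stands in the next free slot. Keeping it means advancing
  pointer and length; otherwise the next pair overwrites it.\<close>

definition pair_step :: com where
  "pair_step = merge_loop ;; search_loop ;; is_eq 17 33 0 ;; For 17 (Instr (Add 21 21 3) ;; inc 22)"

lemma writes_pair_step: "writes pair_step =
    {2, 13, 14, 15, 16, 17, 18, 21, 22, 29, 30, 31, 32, 33, 34, 35, 36, 37, 38, 39}"
  unfolding pair_step_def by (auto simp: writes_merge_loop writes_search_loop)

lemma wp_pair_step:
  assumes n: "R 3 = n" "n \<le> B" "1 \<le> B" "R 22 \<le> B" and q: "R 21 = R 23 + R 22 * n"
    and pos: "R 25 + n \<le> R 23" "R 29 + n \<le> R 23"
    and post: "\<And>R' M'. \<lbrakk>\<forall>a<R 23. M' a = M a; R' 21 = R 23 + R' 22 * n;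
      vecs n M' (R 23) (R' 22) = join_one n (vec n M (R 25)) (vec n M (R 29)) (vecs n M (R 23) (R 22));
      R' 29 = R 29 + n;
      \<And>x. x \<notin> writes pair_step \<Longrightarrow> R' x = R x\<rbrakk> \<Longrightarrow> Q R' M'"
  shows "wp B pair_step Q R M"
  apply (rule wp_frame)
  unfolding writes_pair_step
  unfolding pair_step_def wp_simps
  apply (rule wp_merge_loop[where n = n])
      apply (use n pos q in simp_all)[4]
  subgoal for R1 M1
    apply (rule wp_search_loop[where n = n])
       apply (use n in simp_all)[3]
    subgoal premises prems for R2
    proof -
      let ?x = "vec n M (R 25)" and ?y = "vec n M (R 29)" and ?zs = "vecs n M (R 23) (R 22)"
      have "vecs n M1 (R 23) (R 22) = ?zs"
        using prems(1) q by (intro vecs_cong) auto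
      then have z: "vecs n M1 (R1 23) (R1 22) = ?zs" "vec n M1 (R1 21) = merge ?x ?y"
        using prems by simp_all
      have c: "R2 33 = 0 \<longleftrightarrow> \<not> conflict ?x ?y \<and> \<not> (\<exists>z\<in>set ?zs. eqv n (merge ?x ?y) z)"
        using prems(3,6) unfolding z by simp
      show ?thesis
      proof (cases "R2 33 = 0")
        case True
        then have "join_one n ?x ?y ?zs = vecs n M1 (R 23) (Suc (R 22))"
          using c z prems q by (simp add: join_one_def vecs_Suc)
        then show ?thesis
          apply (simp add: True)
          apply (rule wp_If)
          using True n prems q by (auto intro!: post simp: writes_pair_step)
      next
        case False
        then have "join_one n ?x ?y ?zs = vecs n M1 (R 23) (R 22)"
          using c z prems by (auto simp: join_one_def)
        then show ?thesis
          apply (simp add: False)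
          apply (rule wp_If)
          using False n prems q by (auto intro!: post simp: writes_pair_step)
      qed
    qed
    done
  done

text \<open>Lists only grow, so a bound on the final length bounds every loop over an intermediate
  list.\<close>

lemma length_fold_take:
  assumes "\<And>x s. length s \<le> length (f x s)"
  shows "length (fold f (take i xs) s) \<le> length (fold f xs s)"
proof -
  have "length s \<le> length (fold f ys s)" for ys s
    by (induction ys arbitrary: s) (auto intro: order.trans[OF assms])
  then show ?thesis by (metis append_take_drop_id comp_apply fold_append)
qed

definition row_step :: com where
  "row_step = mov 29 27 ;; mov 28 26 ;; For 28 pair_step ;; Instr (Add 25 25 3)"

lemma writes_row_step: "writes row_step = {25, 28} \<union> writes pair_step"
  unfolding row_step_def by (auto simp: writes_pair_step)

lemma wp_row_step:
  fixes R M n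
  defines "x \<equiv> vec n M (R 25)" and "ys \<equiv> vecs n M (R 27) (R 26)" and "zs \<equiv> vecs n M (R 23) (R 22)"
  assumes n: "R 3 = n" "n \<le> B" "1 \<le> B" "R 26 \<le> B" and q: "R 21 = R 23 + R 22 * n"
    and pos: "R 25 + n \<le> R 23" "R 27 + R 26 * n \<le> R 23"
    and len: "length (fold (join_one n x) ys zs) \<le> B"
    and post: "\<And>R' M'. \<lbrakk>\<forall>a<R 23. M' a = M a; R' 21 = R 23 + R' 22 * n;
      vecs n M' (R 23) (R' 22) = fold (join_one n x) ys zs; R' 25 = R 25 + n;
      \<And>x. x \<notin> writes row_step \<Longrightarrow> R' x = R x\<rbrakk> \<Longrightarrow> Q R' M'"
  shows "wp B row_step Q R M"
  apply (rule wp_frame)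
  unfolding writes_row_step
  unfolding row_step_def
  apply simp
  apply (rule wp_For[where Inv = "\<lambda>i R' M'. (\<forall>a<R 23. M' a = M a) \<and> R' 21 = R 23 + R' 22 * n \<and>
     vecs n M' (R 23) (R' 22) = fold (join_one n x) (take i ys) zs \<and> R' 29 = R 27 + i * n"])
  subgoal using n by simp
  subgoal by simp
  subgoal by (simp add: writes_pair_step)
  subgoal using q by (simp add: zs_def)
  subgoal premises prems for i R' M'
  proof -
    have i: "i < R 26" using prems(1) by simp
    then have "Suc i * n \<le> R 26 * n" by (intro mult_le_mono1) simp
    then have p: "R 27 + i * n + n \<le> R 23" using pos(2) by simp
    have same: "vec n M' (R 25) = x" "vec n M' (R 27 + i * n) = ys ! i"
      using prems(2) p pos(1) i by (auto simp: x_def ys_def vec_def)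
    have "R' 22 = length (fold (join_one n x) (take i ys) zs)"
      using prems(2) length_vecs by metis
    also have "\<dots> \<le> B" using length_fold_take[of "join_one n x"] length_join_one len order.trans by blast
    finally have c: "R' 22 \<le> B" .
    have t: "take (Suc i) ys = take i ys @ [ys ! i]"
      using i by (simp add: ys_def take_Suc_conv_app_nth)
    have R': "R' 3 = n" "R' 23 = R 23" "R' 25 = R 25"
      using prems(4) n(1) by (simp_all add: writes_pair_step)
    show ?thesis
      apply (rule wp_pair_step[where n = n])
      using n R' c p pos prems(2) by (simp_all add: same t writes_pair_step)
  qed
  subgoal premises prems for R' M'
    using prems n(1) by (auto intro!: post simp: writes_pair_step writes_row_step ys_def)
  done

text \<open>The stack of lists is a linked list of blocks below the address \<open>b\<close>: the address of the next block, the
  length of the list, and its vectors.  Blocks are never overwritten.\<close>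

primrec stack_at :: "nat \<Rightarrow> (nat \<Rightarrow> nat) \<Rightarrow> nat \<Rightarrow> (nat \<Rightarrow> nat) list list \<Rightarrow> nat \<Rightarrow> bool" where
  "stack_at n M b [] = (\<lambda>p. True)"
| "stack_at n M b (xs # st) = (\<lambda>p. p + 2 + length xs * n \<le> b \<and> M (p + 1) = length xs \<and>
     vecs n M (p + 2) (length xs) = xs \<and> stack_at n M b st (M p))"

lemma stack_at_cong:
  assumes "\<forall>a<b. M' a = M a" "b \<le> b'" "stack_at n M b st p"
  shows "stack_at n M' b' st p"
  using assms(3)
proof (induction st arbitrary: p)
  case (Cons xs st)
  then have "vecs n M' (p + 2) (length xs) = vecs n M (p + 2) (length xs)"
    using assms(1) by (intro vecs_cong) auto
  then show ?case using Cons assms(1,2) by auto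
qed simp

text \<open>Both operands are popped by giving the new block the link of the left operand. Its
  length cell is filled in last, when the length is known.\<close>

definition join_step :: com where
  "join_step = Instr (Load 19 9) ;; Instr (Load 14 19) ;; Instr (Store 8 14) ;; mov 20 8 ;; inc 20 ;;
     mov 23 20 ;; inc 23 ;; mov 21 23 ;; Instr (Const 22 0) ;;
     mov 14 19 ;; inc 14 ;; Instr (Load 24 14) ;; inc 14 ;; mov 25 14 ;;
     mov 14 9 ;; inc 14 ;; Instr (Load 26 14) ;; inc 14 ;; mov 27 14 ;;
     For 24 row_step ;; Instr (Store 20 22) ;; mov 9 8 ;; mov 8 21"

lemma writes_join_step: "writes join_step = {8, 9, 19, 20, 23, 24, 26, 27} \<union> writes row_step"
  unfolding join_step_def by (auto simp: writes_row_step writes_pair_step)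

lemma wp_join_step:
  assumes n: "R 3 = n" "n \<le> B" "1 \<le> B"
    and st: "stack_at n M (R 8) (ys # xs # st) (R 9)"
    and len: "length xs \<le> B" "length ys \<le> B" "length (join n xs ys) \<le> B"
    and post: "\<And>R' M'. \<lbrakk>\<forall>a<R 8. M' a = M a; R 8 \<le> R' 8; stack_at n M' (R' 8) (join n xs ys # st) (R' 9);
      \<And>x. x \<notin> writes join_step \<Longrightarrow> R' x = R x\<rbrakk> \<Longrightarrow> Q R' M'"
  shows "wp B join_step Q R M"
proof -
  define h rb lb where "h = R 8" and "rb = R 9" and "lb = M (R 9)"
  define M0 where "M0 = M(h := M lb)"
  have r: "rb + 2 + length ys * n \<le> h" "M (rb + 1) = length ys" "vecs n M (rb + 2) (length ys) = ys"
    and l: "lb + 2 + length xs * n \<le> h" "M (lb + 1) = length xs" "vecs n M (lb + 2) (length xs) = xs"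
    and s: "stack_at n M h st (M lb)"
    using st by (simp_all add: h_def rb_def lb_def)
  have lb: "M rb = lb" by (simp add: lb_def rb_def)
  have M0: "M0 (rb + 1) = length ys" "M0 (lb + 1) = length xs" "\<forall>a<h. M0 a = M a" "M0 h = M lb"
    using r l by (auto simp: M0_def)
  show ?thesis
    apply (rule wp_frame)
    unfolding writes_join_step
    unfolding join_step_def
    apply (simp flip: h_def rb_def add: lb M0_def[symmetric])
    using M0(1,2)
    apply simp
    apply (rule wp_For[where Inv = "\<lambda>i R' M'. (\<forall>a<h + 2. M' a = M0 a) \<and> R' 21 = h + 2 + R' 22 * n \<and>
       vecs n M' (h + 2) (R' 22) = fold (\<lambda>x. fold (join_one n x) ys) (take i xs) [] \<and> R' 25 = lb + 2 + i * n"])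
    subgoal using len by simp
    subgoal by simp
    subgoal by (simp add: writes_row_step writes_pair_step)
    subgoal by simp
    subgoal premises prems for i R' M'
    proof -
      have i: "i < length xs" using prems by simp
      then have "Suc i * n \<le> length xs * n" by (intro mult_le_mono1) simp
      then have p: "lb + 2 + i * n + n \<le> h" using l(1) by simp
      have same: "\<forall>a<h. M' a = M a" using prems M0(3) by simp
      have x: "vec n M' (lb + 2 + i * n) = xs ! i"
      proof -
        have "vec n M' (lb + 2 + i * n) = vecs n M (lb + 2) (length xs) ! i"
          using i same p by (auto simp: vec_def)
        then show ?thesis using l(3) by simp
      qed
      have "vecs n M' (rb + 2) (length ys) = vecs n M (rb + 2) (length ys)"
        using same r(1) by (intro vecs_cong) auto
      then have y: "vecs n M' (rb + 2) (length ys) = ys" using r(3) by simp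
      have t: "take (Suc i) xs = take i xs @ [xs ! i]"
        using i by (simp add: take_Suc_conv_app_nth)
      have "length (fold (\<lambda>x. fold (join_one n x) ys) (take (Suc i) xs) []) \<le> length (join n xs ys)"
        unfolding join_def by (rule length_fold_take) (rule length_fold_join_one)
      then have c: "length (fold (join_one n (xs ! i)) ys (vecs n M' (h + 2) (R' 22))) \<le> B"
        using len(3) prems by (simp add: t)
      have R': "R' 3 = n" "R' 23 = h + 2" "R' 26 = length ys" "R' 27 = rb + 2"
        using prems n(1) by (simp_all add: writes_row_step writes_pair_step)
      show ?thesis
        apply (rule wp_row_step[where n = n])
        using n R' c p r prems x y len by (simp_all add: t writes_row_step writes_pair_step)
    qed
    subgoal premises prems for R' M'
    proof -
      let ?c = "R' 22" and ?M = "M'(h + 1 := R' 22)"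
      have same: "\<forall>a<h. M' a = M a" "M' h = M lb" using prems M0 by simp_all
      have j: "vecs n M' (h + 2) ?c = join n xs ys" using prems by (simp add: join_def)
      then have lenj: "?c = length (join n xs ys)" using length_vecs by metis
      have "vecs n ?M (h + 2) ?c = vecs n M' (h + 2) ?c" by (intro vecs_cong) auto
      then have v: "vecs n ?M (h + 2) (length (join n xs ys)) = join n xs ys" using j lenj by simp
      have "stack_at n ?M (h + 2 + ?c * n) st (M lb)"
        using same s by (elim stack_at_cong[rotated 2]) auto
      then have k: "stack_at n ?M (h + 2 + ?c * n) (join n xs ys # st) h"
        using v lenj same by simp
      have R': "R' 8 = h" "R' 20 = h + 1" "R' 21 = h + 2 + ?c * n"
        using prems by (simp_all add: writes_row_step writes_pair_step h_def)
      show ?thesis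
        apply (simp add: R' flip: h_def)
        apply (intro impI)
        apply (rule post)
        using k same R' apply (simp_all flip: h_def add: lenj writes_join_step)
        done
    qed
    done
qed

text \<open>The start \<open>2 + v * n\<close> of the adjacency row is reached by repeated addition.
  An entry for \<open>H\<close> is the one for \<open>G\<close> minus \<open>1 - (t + t')\<close>,
  truncated, where \<open>t\<close> and \<open>t'\<close> tell membership in \<open>T\<close>. Entry
  \<open>v\<close> is overwritten by 2 and by 3 at the end.\<close>

definition leaf_step :: com where
  "leaf_step = Instr (Store 8 9) ;; mov 9 8 ;; mov 42 8 ;; inc 42 ;; Instr (Const 14 2) ;; Instr (Store 42 14) ;; inc 42 ;;
     Instr (Const 14 1) ;; Instr (Sub 40 10 14) ;;
     Instr (Const 41 2) ;; mov 13 40 ;; For 13 (Instr (Add 41 41 3)) ;;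
     Instr (Add 43 42 3) ;; Instr (Add 47 5 40) ;; Instr (Load 47 47) ;;
     mov 46 5 ;; mov 44 42 ;; mov 45 43 ;; Instr (Const 17 0) ;; Instr (Const 18 1) ;; mov 13 3 ;;
     For 13 (Instr (Store 44 17) ;; Instr (Load 14 46) ;; Instr (Add 14 14 47) ;; Instr (Sub 14 18 14) ;;
       Instr (Load 15 41) ;; Instr (Sub 15 15 14) ;; Instr (Store 45 15) ;;
       inc 44 ;; inc 45 ;; inc 46 ;; inc 41) ;;
     mov 8 45 ;;
     Instr (Add 42 42 40) ;; Instr (Const 14 2) ;; Instr (Store 42 14) ;;
     Instr (Add 43 43 40) ;; Instr (Const 14 3) ;; Instr (Store 43 14)"

lemma writes_leaf_step:
  "writes leaf_step = {2, 8, 9, 13, 14, 15, 17, 18, 40, 41, 42, 43, 44, 45, 46, 47}"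
  unfolding leaf_step_def by auto

text \<open>The flag 12 is computed before the first conditional resets flag 11.\<close>

definition token_step :: com where
  "token_step = Instr (Load 10 6) ;; inc 6 ;; is_eq 11 10 0 ;; is_eq 12 11 0 ;;
     For 11 join_step ;; For 12 leaf_step"

lemma writes_token_step:
  "writes token_step = {6, 10, 11, 12} \<union> writes join_step \<union> writes leaf_step"
  unfolding token_step_def
  by (auto simp: writes_join_step writes_row_step writes_pair_step writes_leaf_step)

text \<open>The test \<open>n - w \<le> k\<close> is the vanishing of \<open>n - w - k\<close>; the
  last two comparisons turn the count 48 into 0 or 1.\<close>

definition output_step :: com where
  "output_step = inc 9 ;; Instr (Load 7 9) ;; inc 9 ;; Instr (Const 48 0) ;;
     For 7 (Instr (Const 16 0) ;; Instr (Const 15 2) ;; mov 13 3 ;;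
       For 13 (Instr (Load 14 9) ;; Instr (Sub 14 14 15) ;; Instr (Add 16 16 14) ;; inc 9) ;;
       Instr (Sub 14 3 16) ;; Instr (Sub 14 14 4) ;; is_eq 17 14 0 ;; Instr (Add 48 48 17)) ;;
     is_eq 14 48 0 ;; is_eq 0 14 0"

lemma wp_output_step:
  assumes n: "R 3 = n" "n \<le> B" "length xs \<le> B" and st: "stack_at n M b (xs # st) (R 9)"
    and post: "\<And>R'. R' 0 = of_bool (\<exists>x\<in>set xs. n - weight n x \<le> R 4) \<Longrightarrow> Q R' M"
  shows "wp B output_step Q R M"
proof -
  define p where "p = R 9"
  have xs: "M (Suc p) = length xs" "vecs n M (p + 2) (length xs) = xs" using st by (simp_all add: p_def)
  show ?thesis
    unfolding output_step_def
    apply (simp flip: p_def add: xs(1))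
    apply (rule wp_For[where Inv = "\<lambda>i R' M'. M' = M \<and> R' 9 = p + 2 + i * n \<and>
       (R' 48 = 0 \<longleftrightarrow> \<not> (\<exists>x\<in>set (take i xs). n - weight n x \<le> R 4))"])
    subgoal using n by simp
    subgoal by simp
    subgoal by simp
    subgoal by simp
    subgoal premises prems for i R' M'
    proof -
      have i: "i < length xs" using prems by simp
      have "xs ! i = vecs n M (p + 2) (length xs) ! i" using xs(2) by simp
      then have w: "weight n (xs ! i) = (\<Sum>u<n. M (p + 2 + i * n + u) - 2)"
        using i by (simp add: weight_vec)
      then have w': "n - weight n (xs ! i) \<le> R 4 \<longleftrightarrow> n \<le> (\<Sum>u<n. M (p + 2 + i * n + u) - 2) + R 4"
        by linarith
      have t: "(\<forall>x\<in>set (take (Suc i) xs). P x) \<longleftrightarrow> (\<forall>x\<in>set (take i xs). P x) \<and> P (xs ! i)" for P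
        using i by (auto simp: take_Suc_conv_app_nth)
      have R': "R' 3 = n" "R' 4 = R 4" using prems n by simp_all
      show ?thesis
        apply (simp add: R')
        apply (rule wp_For[where Inv = "\<lambda>j R'' M'. M' = M \<and> R'' 9 = p + 2 + i * n + j \<and>
           R'' 16 = (\<Sum>u<j. M (p + 2 + i * n + u) - 2)"])
        subgoal using n by simp
        subgoal by simp
        subgoal by simp
        subgoal using prems by simp
        subgoal by (simp add: add.assoc)
        subgoal using prems(2) by (simp add: t w' R' add.assoc)
        done
    qed
    subgoal premises prems for R' M'
      using prems(1)
      apply (simp split del: split_of_bool)
      apply (rule post)
      apply simp
      done
    done
qed

context svc_instance
begin

lemma wp_leaf_step:
  assumes n: "R 3 = n" "n \<le> B" "R 10 = Suc v" "v < n" and T: "R 5 = 2 + n * n" "2 + n * n + n \<le> R 8"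
    and st: "stack_at n M (R 8) st (R 9)"
    and adj: "\<And>u. u < n \<Longrightarrow> M (2 + v * n + u) = of_bool ({v, u} \<in> E)"
    and inT: "\<And>u. u < n \<Longrightarrow> M (2 + n * n + u) = of_bool (u \<in> T)"
    and post: "\<And>R' M'. \<lbrakk>\<forall>a<R 8. M' a = M a; R 8 \<le> R' 8; stack_at n M' (R' 8) (singleton_list v # st) (R' 9);
      \<And>x. x \<notin> writes leaf_step \<Longrightarrow> R' x = R x\<rbrakk> \<Longrightarrow> Q R' M'"
  shows "wp B leaf_step Q R M"
proof -
  define h where "h = R 8"
  define M1 where "M1 = M(h := R 9, Suc h := 2)"
  have "Suc v * n \<le> n * n" using n(4) by (intro mult_le_mono1) simp
  then have row: "2 + v * n + n \<le> 2 + n * n" by simp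
  have M1: "M1 (2 + v * n + u) = of_bool ({v, u} \<in> E)" "M1 (2 + n * n + u) = of_bool (u \<in> T)" if "u < n" for u
    using that adj[OF that] inT[OF that] row T(2) by (simp_all add: M1_def h_def)
  have low: "\<forall>a<h. M1 a = M a" "M1 h = R 9" "M1 (h + 1) = 2" by (simp_all add: M1_def)
  have v: "v \<le> B" using n by simp
  have entry: "of_bool ({v, u} \<in> E) - (Suc 0 - (of_bool (u \<in> T) + of_bool (v \<in> T))) = (of_bool (adj v u) :: nat)" for u
    by (auto simp: adj_def)
  show ?thesis
    apply (rule wp_frame)
    unfolding writes_leaf_step
    unfolding leaf_step_def
    apply (simp flip: h_def add: n M1_def[symmetric])
    apply (rule wp_For[where Inv = "\<lambda>i R' M'. R' 41 = 2 + i * n \<and> M' = M1"])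
    subgoal using v by simp
    subgoal by simp
    subgoal by simp
    subgoal by simp
    subgoal by (simp add: n)
    subgoal for R1 M'
      apply (simp add: n T M1(2)[OF n(4), simplified] split del: split_of_bool)
      apply (rule wp_For[where Inv = "\<lambda>i R' M'. R' 44 = h + 2 + i \<and> R' 45 = h + 2 + n + i \<and>
          R' 46 = 2 + n * n + i \<and> R' 41 = 2 + v * n + i \<and> (\<forall>a<h + 2. M' a = M1 a) \<and>
          (\<forall>u<i. M' (h + 2 + u) = 0) \<and> (\<forall>u<i. M' (h + 2 + n + u) = of_bool (adj v u))"])
      subgoal using n by simp
      subgoal by simp
      subgoal by simp
      subgoal by simp
      subgoal premises prems for i R' M'
        using prems row T(2) M1[of i, simplified] entry[of i] n
        by (simp add: All_less_Suc h_def)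
      subgoal premises prems for R' M'
      proof -
        let ?M = "M'(h + 2 + v := 2, h + 2 + n + v := 3)"
        have s: "\<forall>a<h. ?M a = M a" "?M h = R 9" "?M (h + 1) = 2"
          using prems low by auto
        have "vec n ?M (h + 2) = code {v} {}" "vec n ?M (h + 2 + n) = code {v} {v}"
          using prems n adj_less by (auto simp: vec_def code_def fun_eq_iff)
        then have "vecs n ?M (h + 2) 2 = singleton_list v"
          by (simp add: vecs_def singleton_list_def numeral_2_eq_2)
        moreover have "stack_at n ?M (h + 2 + n + n) st (R 9)"
          using s st unfolding h_def by (elim stack_at_cong[rotated 2]) auto
        moreover have "length (singleton_list v) = 2" by (simp add: singleton_list_def)
        ultimately have k: "stack_at n ?M (h + 2 + n + n) (singleton_list v # st) h"
          using s by simp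
        show ?thesis
          using prems
          apply simp
          apply (rule post)
          using k s by (simp_all flip: h_def add: writes_leaf_step)
      qed
      done
    done
qed

lemma wp_token_step:
  assumes n: "R 3 = n" "n \<le> B" "1 \<le> B" and T: "R 5 = 2 + n * n" "2 + n * n + n \<le> R 8"
    and st: "stack_at n M (R 8) st (R 9)"
    and adj: "\<And>v u. v < n \<Longrightarrow> u < n \<Longrightarrow> M (2 + v * n + u) = of_bool ({v, u} \<in> E)"
    and inT: "\<And>u. u < n \<Longrightarrow> M (2 + n * n + u) = of_bool (u \<in> T)"
    and tok: "M (R 6) = 0 \<longrightarrow> 2 \<le> length st" "M (R 6) \<le> n"
    and len: "\<forall>xs\<in>set st. length xs \<le> B" "\<forall>xs\<in>set (push_token (M (R 6)) st). length xs \<le> B"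
    and post: "\<And>R' M'. \<lbrakk>\<forall>a<R 8. M' a = M a; R 8 \<le> R' 8; R' 6 = R 6 + 1;
      stack_at n M' (R' 8) (push_token (M (R 6)) st) (R' 9);
      \<And>x. x \<notin> writes token_step \<Longrightarrow> R' x = R x\<rbrakk> \<Longrightarrow> Q R' M'"
  shows "wp B token_step Q R M"
proof (cases "M (R 6) = 0")
  case True
  then obtain ys xs st' where s: "st = ys # xs # st'"
    using tok(1) by (cases st; cases "tl st") auto
  have p: "push_token (M (R 6)) st = join n xs ys # st'"
    using True by (simp add: push_token_def s)
  have l: "length xs \<le> B" "length ys \<le> B" "length (join n xs ys) \<le> B"
    using len by (simp_all add: s p[unfolded s])
  show ?thesis
    apply (rule wp_frame)
    unfolding writes_token_step
    unfolding token_step_def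
    apply (simp add: True)
    apply (rule wp_If)
    subgoal using n by simp
    subgoal by simp
    subgoal by simp
    subgoal by (simp add: writes_join_step writes_row_step writes_pair_step)
    subgoal by simp
    subgoal
      apply (rule wp_join_step[where n = n and xs = xs and ys = ys and st = st'])
      subgoal using n by simp
      subgoal using n by simp
      subgoal using n by simp
      subgoal using st by (simp add: s)
      subgoal using l by simp
      subgoal using l by simp
      subgoal using l by simp
      subgoal premises prems for R' M'
      proof -
        have R': "R' 12 = 0" "R' 6 = R 6 + 1"
          using prems(4,5) by (simp_all add: writes_join_step writes_row_step writes_pair_step)
        show ?thesis
          apply (rule wp_If)
          using R' prems by (auto intro!: post simp: p writes_token_step writes_leaf_step
              writes_join_step writes_row_step writes_pair_step)
      qed
      done
    done
next
  case False
  then obtain v where v: "M (R 6) = Suc v" "v < n"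
    using tok(2) by (cases "M (R 6)") auto
  have p: "push_token (M (R 6)) st = singleton_list v # st"
    by (simp add: push_token_def v)
  show ?thesis
    apply (rule wp_frame)
    unfolding writes_token_step
    unfolding token_step_def
    apply (simp add: v)
    apply (rule wp_If)
    subgoal using n by simp
    subgoal by simp
    subgoal by simp
    subgoal by (simp add: writes_join_step writes_row_step writes_pair_step)
    subgoal
      apply (rule wp_If)
      subgoal using n by simp
      subgoal by simp
      subgoal by simp
      subgoal by (simp add: writes_leaf_step)
      subgoal by simp
      subgoal
        apply (rule wp_leaf_step[where v = v and st = st])
        subgoal using n by simp
        subgoal using n by simp
        subgoal by simp
        subgoal using v by simp
        subgoal using T by simp
        subgoal using T by simp
        subgoal using st by simp
        subgoal using adj v by simp
        subgoal using inT by simp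
        subgoal premises prems for R' M'
        proof -
          have "R' 6 = R 6 + 1" using prems(4-) by (simp add: writes_leaf_step)
          then show ?thesis
            apply (intro impI)
            apply (rule post)
            using prems(3-5) by (simp_all add: p writes_token_step)
        qed
        done
      done
    subgoal by simp
    done
qed

end

definition init_step :: com where
  "init_step = Instr (Const 14 0) ;; Instr (Load 3 14) ;; inc 14 ;; Instr (Load 4 14) ;;
     Instr (Const 5 2) ;; mov 13 3 ;; For 13 (Instr (Add 5 5 3)) ;;
     Instr (Add 6 5 3) ;; Instr (Add 7 3 3) ;; Instr (Const 14 1) ;; Instr (Sub 7 7 14) ;;
     Instr (Add 8 6 7) ;; Instr (Const 9 0)"

definition solver :: com where
  "solver = init_step ;; For 7 token_step ;; output_step"

lemma wp_init_step:
  assumes "M 0 = n" "M 1 = k" "n \<le> B"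
    and post: "\<And>R'. \<lbrakk>R' 3 = n; R' 4 = k; R' 5 = 2 + n * n; R' 6 = 2 + n * n + n; R' 7 = 2 * n - 1;
      R' 8 = 2 + n * n + n + (2 * n - 1)\<rbrakk> \<Longrightarrow> Q R' M"
  shows "wp B init_step Q R M"
  unfolding init_step_def
  using assms(1,2)
  apply simp
  apply (rule wp_For[where Inv = "\<lambda>i R' M'. M' = M \<and> R' 5 = 2 + i * n"])
  using assms(3) by (auto intro!: post)

lemma wf_solver: "wf_com solver"
  unfolding solver_def init_step_def token_step_def join_step_def leaf_step_def output_step_def
    row_step_def pair_step_def merge_loop_def search_loop_def compare_loop_def
  by simp

text \<open>The deepest nest consists of the tokens, the conditional around the join, the left list,
  the right list, the output list and the entries of a vector.\<close>

lemma depth_solver: "depth solver = 6"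
  unfolding solver_def init_step_def token_step_def join_step_def leaf_step_def output_step_def
    row_step_def pair_step_def merge_loop_def search_loop_def compare_loop_def inc_def mov_def is_eq_def
  by simp

lemma length_grid: "length (concat (map (\<lambda>i. map (f i) [0..<n]) [0..<m])) = m * n"
  by (induction m) auto

lemma nth_grid:
  "i < m \<Longrightarrow> j < n \<Longrightarrow> concat (map (\<lambda>i. map (f i) [0..<n]) [0..<m]) ! (i * n + j) = f i j"
proof (induction m)
  case (Suc m)
  show ?case
  proof (cases "i < m")
    case True
    then have "Suc i * n \<le> m * n" by (intro mult_le_mono1) simp
    then have "i * n + j < m * n" using Suc.prems(2) by simp
    then show ?thesis using Suc True by (simp add: nth_append length_grid)
  next
    case False
    then show ?thesis using Suc.prems by (simp add: nth_append length_grid less_Suc_eq)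
  qed
qed simp

section \<open>Correctness of the whole program\<close>

context svc_layout
begin

lemma length_tokens: "length (encode_layout {..<n} \<delta> [] L) = 2 * n - 1"
  using length_encode_layout[of "{..<n}" "[]" L] card_leaves by simp

lemma nth_encode_instance:
  defines "w k \<equiv> encode_instance n E T k L \<delta>"
  shows "length (w k) = 2 + n * n + n + (2 * n - 1)" "w k ! 0 = n" "w k ! 1 = k"
    "i < n \<Longrightarrow> j < n \<Longrightarrow> w k ! (2 + i * n + j) = of_bool ({i, j} \<in> E)"
    "i < n \<Longrightarrow> w k ! (2 + n * n + i) = of_bool (i \<in> T)"
    "w k ! (2 + n * n + n + i) = encode_layout {..<n} \<delta> [] L ! i"
proof -
  have w: "w k = n # k # concat (map (\<lambda>i. map (\<lambda>j. of_bool ({i, j} \<in> E)) [0..<n]) [0..<n]) @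
      map (\<lambda>i. of_bool (i \<in> T)) [0..<n] @ encode_layout {..<n} \<delta> [] L"
    by (simp add: w_def encode_instance_def)
  show "length (w k) = 2 + n * n + n + (2 * n - 1)"
    by (simp add: w length_grid length_tokens)
  show "w k ! 0 = n" "w k ! 1 = k" by (simp_all add: w)
  show "w k ! (2 + i * n + j) = of_bool ({i, j} \<in> E)" if "i < n" "j < n"
  proof -
    have "Suc i * n \<le> n * n" using that by (intro mult_le_mono1) simp
    then have "i * n + j < n * n" using that by simp
    then show ?thesis using that by (simp add: w nth_append length_grid nth_grid)
  qed
  show "w k ! (2 + n * n + i) = of_bool (i \<in> T)" if "i < n"
    using that by (simp add: w nth_append length_grid)
  show "w k ! (2 + n * n + n + i) = encode_layout {..<n} \<delta> [] L ! i"
    by (simp add: w nth_append length_grid)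
qed

lemma wp_solver:
  assumes B: "2 * n \<le> B" "(n + 1) ^ (2 * layout_mim {..<n} E L \<delta> + 1) \<le> B"
    and M: "\<And>a. a < length (encode_instance n E T k L \<delta>) \<Longrightarrow> M a = encode_instance n E T k L \<delta> ! a"
  shows "wp B solver (\<lambda>R' M'. R' 0 = (if subset_vertex_cover {..<n} E T k then 1 else 0)) R M"
proof -
  let ?toks = "encode_layout {..<n} \<delta> [] L"
  define h where "h = 2 + n * n + n + (2 * n - 1)"
  note enc = nth_encode_instance[where k = k]
  have low: "2 + i * n + j < 2 + n * n" if "i < n" "j < n" for i j
  proof -
    have "Suc i * n \<le> n * n" using that by (intro mult_le_mono1) simp
    then show ?thesis using that by simp
  qed
  have M0: "M 0 = n" "M 1 = k" using M enc(1-3) by simp_all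
  have adj: "M (2 + i * n + j) = of_bool ({i, j} \<in> E)" if "i < n" "j < n" for i j
    using M[of "2 + i * n + j"] enc(1) enc(4)[OF that] low[OF that] by simp
  have inT: "M (2 + n * n + i) = of_bool (i \<in> T)" if "i < n" for i
    using M[of "2 + n * n + i"] enc(1) enc(5)[OF that] that by simp
  have tok: "M (2 + n * n + n + i) = ?toks ! i" if "i < 2 * n - 1" for i
    using M[of "2 + n * n + n + i"] enc(1) enc(6)[of i] that by simp
  have len: "length (table L []) \<le> B" using length_table[OF subtree_at_root] B(2) by simp
  have safe: "safe B [] ?toks"
    using safe_encode_layout[OF subtree_at_root _ B(2), of "[]" "[]"] by simp
  have fold: "fold push_token ?toks [] = [table L []]" by (rule fold_encode_layout)
  have ans: "(\<exists>x\<in>set (table L []). n - weight n x \<le> k) \<longleftrightarrow> subset_vertex_cover {..<n} E T k"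
  proof
    assume "\<exists>x\<in>set (table L []). n - weight n x \<le> k"
    then obtain x where x: "x \<in> set (table L [])" "n - weight n x \<le> k" by blast
    have "\<forall>x\<in>set (table L []). \<exists>X\<subseteq>{..<n}. indep X \<and> x = code {..<n} X"
      using represents_root by (simp add: represents_def)
    then obtain X where "X \<subseteq> {..<n}" "indep X" "x = code {..<n} X" using x(1) by blast
    then show "subset_vertex_cover {..<n} E T k"
      using x(2) weight_code[of X "{..<n}"] unfolding subset_vertex_cover_iff by auto
  next
    assume "subset_vertex_cover {..<n} E T k"
    then obtain X where X: "X \<subseteq> {..<n}" "indep X" "n - card X \<le> k"
      unfolding subset_vertex_cover_iff by blast
    have "\<forall>X\<subseteq>{..<n}. indep X \<longrightarrow> (\<exists>x\<in>set (table L []). eqv n (code {..<n} X) x)"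
      using represents_root by (simp add: represents_def)
    then obtain x where "x \<in> set (table L [])" "eqv n (code {..<n} X) x" using X by blast
    then show "\<exists>x\<in>set (table L []). n - weight n x \<le> k"
      using X weight_code[of X "{..<n}"] by (auto simp: eqv_def)
  qed
  show ?thesis
    unfolding solver_def wp_simps
    apply (rule wp_init_step[where n = n and k = k])
    subgoal using M0 by simp
    subgoal using M0 by simp
    subgoal using B by simp
    subgoal premises R for R
      apply (rule wp_For[where Inv = "\<lambda>i R' M'. (\<forall>a<h. M' a = M a) \<and> h \<le> R' 8 \<and>
         R' 6 = 2 + n * n + n + i \<and> stack_at n M' (R' 8) (fold push_token (take i ?toks) []) (R' 9)"])
      subgoal using B R by simp
      subgoal by simp
      subgoal by (simp add: writes_token_step writes_join_step writes_row_step writes_pair_step writes_leaf_step)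
      subgoal using R by (simp add: h_def)
      subgoal premises prems for i R' M'
      proof -
        let ?st = "fold push_token (take i ?toks) []"
        have i: "i < 2 * n - 1" using prems(1) R by simp
        then have i': "i < length ?toks" by (simp add: length_tokens)
        have R': "R' 3 = n" "R' 4 = k" "R' 5 = 2 + n * n"
          using prems(4) R
          by (simp_all add: writes_token_step writes_join_step writes_row_step writes_pair_step writes_leaf_step)
        have same: "M' a = M a" if "a < h" for a using prems(2) that by blast
        have "2 + n * n + n + i < h" using i by (simp add: h_def)
        then have t: "M' (R' 6) = ?toks ! i" using prems(2) same tok[OF i] by simp
        have nth: "(?toks ! i = 0 \<longrightarrow> 2 \<le> length ?st) \<and> ?toks ! i \<le> n \<and>
            (\<forall>xs\<in>set (push_token (?toks ! i) ?st). length xs \<le> B)"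
          by (rule safe_nth[OF safe i'])
        \<comment> \<open>The stack before token \<open>i\<close> is the one after the previous
          token, or empty.\<close>
        have lens: "\<forall>xs\<in>set ?st. length xs \<le> B"
        proof (cases i)
          case (Suc j)
          then show ?thesis
            using safe_nth[OF safe, of j] i' by (simp add: take_Suc_conv_app_nth)
        qed simp
        have step: "fold push_token (take (Suc i) ?toks) [] = push_token (?toks ! i) ?st"
          using i' by (simp add: take_Suc_conv_app_nth)
        show ?thesis
          apply (rule wp_token_step[where st = ?st])
          subgoal using R' by simp
          subgoal using B by simp
          subgoal using B n_pos by simp
          subgoal using R' by simp
          subgoal using prems(2) by (simp add: h_def)
          subgoal using prems(2) by simp
          subgoal for v u using same[of "2 + v * n + u"] low[of v u] adj[of v u] by (simp add: h_def)
          subgoal for u using same[of "2 + n * n + u"] inT[of u] by (simp add: h_def)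
          subgoal using nth t by simp
          subgoal using nth t by simp
          subgoal using lens by simp
          subgoal using nth t by simp
          subgoal premises prems2 for R'' M''
            using prems2(1-4) prems(2) t by (simp add: step)
          done
      qed
      subgoal premises prems for R' M'
      proof -
        have "R' 3 = n" "R' 4 = k"
          using prems(3) R
          by (simp_all add: writes_token_step writes_join_step writes_row_step writes_pair_step writes_leaf_step)
        moreover have "stack_at n M' (R' 8) [table L []] (R' 9)"
          using prems(1) R length_tokens fold by simp
        ultimately show ?thesis
          apply (intro wp_output_step[where n = n and xs = "table L []" and st = "[]"])
          using B len ans by auto
      qed
      done
    done
qed

end

lemma solver_outputs:
  assumes "2 * n \<le> B" "(n + 1) ^ (2 * layout_mim {..<n} E L \<delta> + 1) \<le> B"
    and "simple_graph {..<n} E" "rooted_layout {..<n} L \<delta>"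
    and t: "2 * code_length solver * (B + 1) ^ 6 \<le> t"
  shows "outputs_within (compile solver 0) (encode_instance n E T k L \<delta>) t
    (if subset_vertex_cover {..<n} E T k then 1 else 0)"
proof -
  interpret svc_layout n E T L \<delta> using assms by unfold_locales
  let ?w = "encode_instance n E T k L \<delta>"
  have "wp B solver (\<lambda>R' M'. R' 0 = (if subset_vertex_cover {..<n} E T k then 1 else 0))
      (\<lambda>_. 0) (\<lambda>i. if i < length ?w then ?w ! i else 0)"
    using assms by (intro wp_solver[where k = k]) auto
  moreover have "cost B solver \<le> t" using cost_le[of B solver] t unfolding depth_solver by linarith
  ultimately show ?thesis
    unfolding wp_def by (intro compile_outputs_within[OF wf_solver]) (auto simp: initial_def)
qed

text \<open>Serves the case \<open>n = 1\<close>, where powers of \<open>n\<close> absorb nothing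
  and a bound uniform in \<open>m\<close> requires \<open>m = 0\<close>.\<close>

lemma layout_mim_edgeless:
  fixes V :: "'a set"
  shows "layout_mim V {} L \<delta> = 0"
proof -
  have "{card M |M :: 'a set set. induced_matching {} M} = {0}"
    by (auto simp: induced_matching_def matching_def)
  moreover have "cut_edges V {} A = {}" for A by (simp add: cut_edges_def)
  ultimately have "mim V {} A = 0" for A unfolding mim_def by (simp only: Max_singleton)
  moreover have "nodes L \<noteq> {}" by (cases L) auto
  ultimately show ?thesis by (simp add: layout_mim_def image_constant_conv)
qed

theorem theorem14:
  "\<exists>(P :: instr list) (g :: nat \<Rightarrow> nat \<Rightarrow> nat). power_O_bound g \<and>
     (\<forall>n E T k L \<delta>.
        simple_graph {..<n} E \<longrightarrow> rooted_layout {..<n} L \<delta> \<longrightarrow> T \<subseteq> {..<n} \<longrightarrow> 0 < k \<longrightarrow>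
        outputs_within P (encode_instance n E T k L \<delta>) (g n (layout_mim {..<n} E L \<delta>))
          (if subset_vertex_cover {..<n} E T k then 1 else 0))"
proof -
  define K where "K = 2 * code_length solver"
  \<comment> \<open>For \<open>n = 1\<close> and \<open>m = 0\<close> the number
    \<open>B + 1\<close> below is 5, whence \<open>5 ^ 6\<close>. For \<open>n \<ge> 2\<close> it is
    at most \<open>n ^ (4 * m + 4)\<close>, whose sixth power has exponent
    \<open>24 * m + 24\<close>.\<close>
  define g :: "nat \<Rightarrow> nat \<Rightarrow> nat" where "g = (\<lambda>n m. (K * 5 ^ 6) * n ^ (24 * m + 24))"
  have "(\<lambda>m. real (24 * m + 24)) \<in> O(\<lambda>m. real m)"
    by (intro bigoI[of _ 48] eventually_mono[OF eventually_ge_at_top[of 1]]) auto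
  then have "power_O_bound g" unfolding power_O_bound_def g_def
    by (intro exI[of _ "K * 5 ^ 6"] exI[of _ "\<lambda>m. 24 * m + 24"]) simp
  moreover have "outputs_within (compile solver 0) (encode_instance n E T k L \<delta>) (g n (layout_mim {..<n} E L \<delta>))
          (if subset_vertex_cover {..<n} E T k then 1 else 0)"
    if G: "simple_graph {..<n} E" and L: "rooted_layout {..<n} L \<delta>" for n E T k L \<delta>
  proof -
    interpret svc_layout n E T L \<delta> using G L by unfold_locales
    define m where "m = layout_mim {..<n} E L \<delta>"
    define B where "B = 2 * (n + 1) ^ (2 * m + 1)"
    have pow: "n + 1 \<le> (n + 1) ^ (2 * m + 1)" using self_le_power[of "n + 1" "2 * m + 1"] by simp
    have B: "2 * n \<le> B" "(n + 1) ^ (2 * layout_mim {..<n} E L \<delta> + 1) \<le> B"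
      using pow unfolding B_def m_def by linarith+
    have "K * (B + 1) ^ 6 \<le> g n m"
    proof (cases "n = 1")
      case True
      have "E = {}"
      proof (rule equals0I)
        fix e assume "e \<in> E"
        then have "e \<subseteq> {..<1}" "card e = 2" using G True by (auto simp: simple_graph_def)
        then show False using card_mono[of "{..<1::nat}" e] by simp
      qed
      then have "m = 0" by (simp add: m_def layout_mim_edgeless)
      then show ?thesis using True by (simp add: g_def B_def)
    next
      case False
      then have n: "2 \<le> n" using n_pos by simp
      then have "2 * n \<le> n ^ 2" unfolding power2_eq_square by (rule mult_le_mono1)
      \<comment> \<open>These two estimates convert powers of \<open>n + 1\<close> and the constant
        4 into powers of \<open>n\<close>.\<close>
      then have sq: "n + 1 \<le> n ^ 2" "4 \<le> n ^ 2" using n by linarith+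
      have "B + 1 \<le> 4 * (n + 1) ^ (2 * m + 1)" using pow unfolding B_def by linarith
      also have "\<dots> \<le> n ^ 2 * (n ^ 2) ^ (2 * m + 1)"
        using sq by (intro mult_le_mono power_mono) auto
      also have "\<dots> = n ^ (2 + 2 * (2 * m + 1))" by (simp only: power_add power_mult)
      also have "2 + 2 * (2 * m + 1) = 4 * m + 4" by simp
      finally have "(B + 1) ^ 6 \<le> (n ^ (4 * m + 4)) ^ 6" by (rule power_mono) simp
      also have "\<dots> = n ^ (24 * m + 24)" by (simp flip: power_mult)
      finally have "K * (B + 1) ^ 6 \<le> K * n ^ (24 * m + 24)" by simp
      also have "\<dots> \<le> g n m" unfolding g_def by (intro mult_le_mono1) simp
      finally show ?thesis .
    qed
    then show ?thesis
      unfolding K_def m_def by (intro solver_outputs[OF B G L])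
  qed
  ultimately show ?thesis by blast
qed

end
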